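(* Let $k$ be an arbitrary infinite field (of any characteristic). For every integer $r\ge 5$ there exists a sequence $h=(1,h_1=r,h_2,\dots,h_{e-1},h_e=1)$, of codimension $r$ (and of some socle degree $e$), which is the $h$-vector of a standard graded artinian Gorenstein $k$-algebra, is unimodal, and is not an SI-sequence.
   Context: A standard graded artinian $k$-algebra is $A=R/I=\bigoplus_{i\ge 0}[A]_i$, where $R=k[x_1,\dots,x_r]$ has the standard grading and $I$ is a homogeneous ideal with $\dim_k A<\infty$; one assumes that $I$ contains no nonzero forms of degree $1$, and $r$ is called the codimension of $A$. The $h$-vector of $A$ is $h=(1,h_1,\dots,h_e)$, where $h_i=\dim_k[A]_i$ and $e$, the socle degree of $A$, is the last index with $h_e>0$ (so $h_1=r$). The socle of $A$ is $\{a\in A: a\overline{\mathfrak m}=0\}$, where $\overline{\mathfrak m}=(\overline{x_1},\dots,\overline{x_r})$. $A$ is level of type $t$ if its socle is a $t$-dimensional $k$-vector space concentrated in degree $e$, and $A$ is Gorenstein if it is level of type $1$. A Gorenstein $h$-vector is the $h$-vector of a Gorenstein algebra. A sequence is unimodal if it never increases strictly after a strict decrease. A sequence $h=(1,h_1,\dots,h_e)$ is symmetric if $h_i=h_{e-i}$ for all $i$. A sequence $(1,h_1,\dots,h_m)$ is differentiable if its first difference $(1,h_1-1,h_2-h_1,\dots,h_m-h_{m-1})$ is, after discarding any trailing zeros, the $h$-vector of some standard graded artinian algebra. A sequence $h=(1,h_1,\dots,h_e)$ is an SI-sequence (satisfies the Stanley-Iarrobino property) if it is symmetric and its first half $(1,h_1,\dots,h_{\lfloor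 e/2\rfloor})$ is differentiable. *)

theory Defs
  imports "HOL-Algebra.Algebra" "HOL-Library.Poly_Mapping"
begin

text \<open>
  Polynomials over \<open>'k\<close> are finitely supported maps from monomials to coefficients, where a
  monomial is a finitely supported exponent map. The variables are indexed by all of \<open>nat\<close>;
  \<open>k[x\<^sub>1,\<dots>,x\<^sub>r]\<close> is the subring of the polynomials that only involve the variables with
  index below \<open>r\<close>.
\<close>

type_synonym 'k mpoly = "(nat \<Rightarrow>\<^sub>0 nat) \<Rightarrow>\<^sub>0 'k"

definition mon_degree :: "(nat \<Rightarrow>\<^sub>0 nat) \<Rightarrow> nat" where
  "mon_degree m = (\<Sum>i\<in>Poly_Mapping.keys m. Poly_Mapping.lookup m i)"

definition mpoly_var :: "nat \<Rightarrow> 'k::field mpoly" where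
  "mpoly_var i = Poly_Mapping.single (Poly_Mapping.single i 1) 1"

definition mpoly_const :: "'k::field \<Rightarrow> 'k mpoly" where
  "mpoly_const c = Poly_Mapping.single 0 c"

definition mpoly_ring :: "nat \<Rightarrow> 'k::field mpoly ring" where
  "mpoly_ring r = \<lparr>carrier = {p. \<forall>m\<in>Poly_Mapping.keys p. Poly_Mapping.keys m \<subseteq> {..<r}},
     monoid.mult = (*), monoid.one = 1, ring.zero = 0, ring.add = (+)\<rparr>"

lemma keys_times_subset_vars:
  assumes "\<forall>m\<in>Poly_Mapping.keys p. Poly_Mapping.keys m \<subseteq> V"
    and "\<forall>m\<in>Poly_Mapping.keys q. Poly_Mapping.keys m \<subseteq> V"
  shows "\<forall>m\<in>Poly_Mapping.keys (p * q :: 'k::field mpoly). Poly_Mapping.keys m \<subseteq> V"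
proof
  fix m assume "m \<in> Poly_Mapping.keys (p * q)"
  then obtain a b where "a \<in> Poly_Mapping.keys p" "b \<in> Poly_Mapping.keys q" "m = a + b"
    using keys_mult[of p q] by blast
  with assms keys_add[of a b] show "Poly_Mapping.keys m \<subseteq> V" by blast
qed

lemma cring_mpoly_ring: "cring (mpoly_ring r :: 'k::field mpoly ring)"
proof (intro cringI abelian_groupI comm_monoidI)
  fix x :: "'k mpoly" assume "x \<in> carrier (mpoly_ring r)"
  then show "\<exists>y\<in>carrier (mpoly_ring r). y \<oplus>\<^bsub>mpoly_ring r\<^esub> x = \<zero>\<^bsub>mpoly_ring r\<^esub>"
    by (intro bexI[of _ "- x"]) (auto simp: mpoly_ring_def in_keys_iff)
next
  fix x y :: "'k mpoly" assume "x \<in> carrier (mpoly_ring r)" "y \<in> carrier (mpoly_ring r)"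
  then show "x \<oplus>\<^bsub>mpoly_ring r\<^esub> y \<in> carrier (mpoly_ring r)"
    using keys_add[of x y] by (fastforce simp: mpoly_ring_def)
next
  fix x y :: "'k mpoly" assume "x \<in> carrier (mpoly_ring r)" "y \<in> carrier (mpoly_ring r)"
  then show "x \<otimes>\<^bsub>mpoly_ring r\<^esub> y \<in> carrier (mpoly_ring r)"
    using keys_times_subset_vars[of x "{..<r}" y] by (simp add: mpoly_ring_def)
qed (auto simp: mpoly_ring_def algebra_simps)

definition forms :: "nat \<Rightarrow> nat \<Rightarrow> 'k::field mpoly set" where
  "forms r d = {p \<in> carrier (mpoly_ring r). \<forall>m\<in>Poly_Mapping.keys p. mon_degree m = d}"

definition homogeneous_component :: "nat \<Rightarrow> 'k::field mpoly \<Rightarrow> 'k mpoly" where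
  "homogeneous_component d p =
     (\<Sum>m | m \<in> Poly_Mapping.keys p \<and> mon_degree m = d. Poly_Mapping.single m (Poly_Mapping.lookup p m))"

definition homogeneous_ideal :: "nat \<Rightarrow> 'k::field mpoly set \<Rightarrow> bool" where
  "homogeneous_ideal r I \<longleftrightarrow>
     ideal I (mpoly_ring r) \<and> (\<forall>p\<in>I. \<forall>d. homogeneous_component d p \<in> I)"

definition quot_alg :: "nat \<Rightarrow> 'k::field mpoly set \<Rightarrow> 'k mpoly set ring" where
  "quot_alg r I = mpoly_ring r Quot I"

definition residue_class :: "nat \<Rightarrow> 'k::field mpoly set \<Rightarrow> 'k mpoly \<Rightarrow> 'k mpoly set" where
  "residue_class r I p = I +>\<^bsub>mpoly_ring r\<^esub> p"

text \<open>
  The copy of \<open>k\<close> inside \<open>A = R/I\<close>; linear algebra over \<open>k\<close> in \<open>A\<close> is linear algebra over this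
  subfield (it is one as soon as \<open>I\<close> is a proper ideal).
\<close>

definition scalars :: "nat \<Rightarrow> 'k::field mpoly set \<Rightarrow> 'k mpoly set set" where
  "scalars r I = residue_class r I ` Set.range mpoly_const"

definition graded_piece :: "nat \<Rightarrow> 'k::field mpoly set \<Rightarrow> nat \<Rightarrow> 'k mpoly set set" where
  "graded_piece r I d = residue_class r I ` forms r d"

text \<open>
  \<open>A = R/I\<close> is required to be nonzero, so that \<open>h\<^sub>0 = 1\<close>. The absence of linear forms in \<open>I\<close>
  makes \<open>r\<close> the codimension of \<open>A\<close>. The case \<open>r = 0\<close>, \<open>A = k\<close> is allowed.
\<close>

definition standard_graded_artinian :: "nat \<Rightarrow> 'k::field mpoly set \<Rightarrow> bool" where
  "standard_graded_artinian r I \<longleftrightarrow>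
     homogeneous_ideal r I \<and> I \<noteq> carrier (mpoly_ring r) \<and> I \<inter> forms r 1 = {0} \<and>
     ring.finite_dimension (quot_alg r I) (scalars r I) (carrier (quot_alg r I))"

definition hilb :: "nat \<Rightarrow> 'k::field mpoly set \<Rightarrow> nat \<Rightarrow> nat" where
  "hilb r I d = ring.dim (quot_alg r I) (scalars r I) (graded_piece r I d)"

definition socle_degree :: "nat \<Rightarrow> 'k::field mpoly set \<Rightarrow> nat" where
  "socle_degree r I = Max {d. hilb r I d > 0}"

definition h_vector :: "nat \<Rightarrow> 'k::field mpoly set \<Rightarrow> nat list" where
  "h_vector r I = map (hilb r I) [0..<socle_degree r I + 1]"

definition max_ideal :: "nat \<Rightarrow> 'k::field mpoly set \<Rightarrow> 'k mpoly set set" where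
  "max_ideal r I = Idl\<^bsub>quot_alg r I\<^esub> ((\<lambda>i. residue_class r I (mpoly_var i)) ` {..<r})"

definition socle :: "nat \<Rightarrow> 'k::field mpoly set \<Rightarrow> 'k mpoly set set" where
  "socle r I = {a \<in> carrier (quot_alg r I).
     \<forall>b\<in>max_ideal r I. a \<otimes>\<^bsub>quot_alg r I\<^esub> b = \<zero>\<^bsub>quot_alg r I\<^esub>}"

definition level_algebra :: "nat \<Rightarrow> 'k::field mpoly set \<Rightarrow> nat \<Rightarrow> bool" where
  "level_algebra r I t \<longleftrightarrow>
     standard_graded_artinian r I \<and>
     ring.dimension (quot_alg r I) t (scalars r I) (socle r I) \<and>
     socle r I \<subseteq> graded_piece r I (socle_degree r I)"

definition gorenstein_algebra :: "nat \<Rightarrow> 'k::field mpoly set \<Rightarrow> bool" where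
  "gorenstein_algebra r I \<longleftrightarrow> level_algebra r I 1"

definition artinian_h_vector :: "'k::field itself \<Rightarrow> nat list \<Rightarrow> bool" where
  "artinian_h_vector K h \<longleftrightarrow>
     (\<exists>r (I :: 'k mpoly set). standard_graded_artinian r I \<and> h = h_vector r I)"

definition gorenstein_h_vector :: "'k::field itself \<Rightarrow> nat list \<Rightarrow> bool" where
  "gorenstein_h_vector K h \<longleftrightarrow>
     (\<exists>r (I :: 'k mpoly set). gorenstein_algebra r I \<and> h = h_vector r I)"

text \<open>A sequence \<open>(h\<^sub>0,\<dots>,h\<^sub>e)\<close> is a list of length \<open>e + 1\<close>.\<close>

definition unimodal :: "nat list \<Rightarrow> bool" where
  "unimodal h \<longleftrightarrow>
     \<not> (\<exists>i j. i < j \<and> Suc j < length h \<and> h ! Suc i < h ! i \<and> h ! j < h ! Suc j)"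

definition symmetric :: "nat list \<Rightarrow> bool" where
  "symmetric h \<longleftrightarrow> (\<forall>i<length h. h ! i = h ! (length h - 1 - i))"

definition first_difference :: "nat list \<Rightarrow> int list" where
  "first_difference h =
     map (\<lambda>i. if i = 0 then int (h ! 0) else int (h ! i) - int (h ! (i - 1))) [0..<length h]"

text \<open>
  For a list starting with \<open>1\<close>. A list with a negative difference is not differentiable, since
  entries of an \<open>h\<close>-vector are natural numbers.
\<close>

definition differentiable_seq :: "'k::field itself \<Rightarrow> nat list \<Rightarrow> bool" where
  "differentiable_seq K h \<longleftrightarrow>
     (\<exists>g. artinian_h_vector K g \<and> strip_while (\<lambda>d. d = 0) (first_difference h) = map int g)"

text \<open>With \<open>e = length h - 1\<close>, the first half, up to index \<open>e div 2\<close>, has \<open>e div 2 + 1\<close> entries.\<close>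

definition SI_sequence :: "'k::field itself \<Rightarrow> nat list \<Rightarrow> bool" where
  "SI_sequence K h \<longleftrightarrow>
     symmetric h \<and> differentiable_seq K (take ((length h - 1) div 2 + 1) h)"

end

(*
  The algebra is apolar to F = y_0 F_0 + y_1 F_1 + z_5^30 + ... + z_{r-1}^30, where F_0 and F_1 are
  sums of two and five monomials of degree 29 in x_0, x_1, x_2 and polynomials act by contraction,
  so that the characteristic plays no role. If a_j is the rank of the pairing between forms of
  degree j in the x_i and pairs of forms of degree 29 - j, given by F_0 and F_1, then
  h_d = a_d + a_{30-d} + (r - 5) for 0 < d < 30. Both F_i are annihilated by
  J = x_2^15 (x_0, x_1), and up to degree 17 nothing else annihilates both, while no pair of forms
  of degree at most 11 maps (F_0, F_1) to 0; this determines all a_j. The two generators of J in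
  degree 16, which span only five dimensions in degree 17, make h_13 = h_14 = h_15 - 1. Thus the
  first difference of the first half has a 0 followed by a 1, which no standard graded algebra
  allows.

  Both rank statements come from sparse systems of equations with coefficients 0 and 1 that can be
  solved by repeatedly finding an equation in which all but one of the unknowns are already known
  to vanish, and this works over every field.
*)
theory Submission
  imports Defs
begin

text \<open>The a_j form the h-vector of k[x_0, x_1, x_2] modulo the common annihilator of F_0 and
  F_1, a level algebra of type 2. Attaching y_0 and y_1 glues to it its canonical module with the
  degrees reversed, whence the summand a_{30-d}. Each z_k^30 adds 1 in every degree from 1 to 29,
  which raises the codimension from 5 to r and moves no difference in between.

  Put D_j = a_j - a_{j-1}, so that h_d - h_{d-1} = D_d - D_{31-d} for 1 < d < 30. If no form of
  degree at most 16 annihilated both F_i, then D_j = j + 1 there, and the step into the middle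
  degree would be D_15 - D_16 = 16 - 17. Two relations in degree 16 turn it into 16 - 15 = 1. Their
  common factor x_2^15 gives them one linear syzygy, so D_17 = 18 - (5 - 2) = 15 and the step before
  is D_14 - D_17 = 15 - 15 = 0. Without the syzygy D_17 would be 14 and that step would be 1 too.

  The bounds 17 and 11 fit together because 29 - 11 = 18: the rank a_j is the number of rows outside
  J for j up to 17 and the full number of columns from j = 18 on.\<close>

section \<open>Triangular systems\<close>

text \<open>\<open>B\<close> indexes a basis of the row space of the matrix with rows
  \<open>M\<close> and columns \<open>N\<close>, so \<open>card B\<close> is its rank. For a
  catalecticant matrix, independence says that no nonzero combination of the monomials in
  \<open>B\<close> lies in the apolar ideal, and spanning says that every monomial reduces to such a
  combination.\<close>

definition row_basis :: "('a \<Rightarrow> 'b \<Rightarrow> 'k::field) \<Rightarrow> 'a set \<Rightarrow> 'b set \<Rightarrow> 'a set \<Rightarrow> bool" where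
  "row_basis A M N B \<longleftrightarrow> finite B \<and> B \<subseteq> M \<and>
     (\<forall>c. (\<forall>y\<in>N. (\<Sum>x\<in>B. c x * A x y) = 0) \<longrightarrow> (\<forall>x\<in>B. c x = 0)) \<and>
     (\<forall>x\<in>M. \<exists>c. \<forall>y\<in>N. A x y = (\<Sum>b\<in>B. c b * A b y))"

lemma row_basis_indep:
  assumes "row_basis A M N B" "\<And>y. y \<in> N \<Longrightarrow> (\<Sum>x\<in>B. c x * A x y) = 0" "x \<in> B"
  shows "c x = 0"
  using assms unfolding row_basis_def by blast

lemma row_basis_zero: "(\<And>x y. x \<in> M \<Longrightarrow> y \<in> N \<Longrightarrow> A x y = 0) \<Longrightarrow> row_basis A M N {}"
  unfolding row_basis_def by simp

text \<open>Block diagonal matrices: on the columns \<open>N1\<close> a combination of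
  \<open>B1\<close> and \<open>B2\<close> sees only \<open>B1\<close>, and conversely. Ranks of
  blocks therefore add.\<close>

lemma row_basis_Un:
  assumes 1: "row_basis A M1 N1 B1" and 2: "row_basis A M2 N2 B2"
    and disj: "M1 \<inter> M2 = {}"
    and zero: "\<And>x y. x \<in> M1 \<Longrightarrow> y \<in> N2 \<Longrightarrow> A x y = 0" "\<And>x y. x \<in> M2 \<Longrightarrow> y \<in> N1 \<Longrightarrow> A x y = 0"
  shows "row_basis A (M1 \<union> M2) (N1 \<union> N2) (B1 \<union> B2)"
proof -
  have fin: "finite B1" "finite B2" and sub: "B1 \<subseteq> M1" "B2 \<subseteq> M2"
    using 1 2 by (auto simp: row_basis_def)
  have dB: "B1 \<inter> B2 = {}" using sub disj by blast
  have split: "(\<Sum>x\<in>B1 \<union> B2. c x * A x y) = (\<Sum>x\<in>B1. c x * A x y) + (\<Sum>x\<in>B2. c x * A x y)" for c y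
    using fin dB by (rule sum.union_disjoint)
  have z1: "(\<Sum>x\<in>B1. c x * A x y) = 0" if "y \<in> N2" for c y
    by (rule sum.neutral) (use zero(1) that sub in auto)
  have z2: "(\<Sum>x\<in>B2. c x * A x y) = 0" if "y \<in> N1" for c y
    by (rule sum.neutral) (use zero(2) that sub in auto)
  show ?thesis unfolding row_basis_def
  proof (intro conjI allI impI ballI)
    fix c x assume c: "\<forall>y\<in>N1 \<union> N2. (\<Sum>x\<in>B1 \<union> B2. c x * A x y) = 0" and x: "x \<in> B1 \<union> B2"
    have "(\<Sum>x\<in>B1. c x * A x y) = 0" if "y \<in> N1" for y
      using c split[of c y] z2[OF that, of c] that by simp
    moreover have "(\<Sum>x\<in>B2. c x * A x y) = 0" if "y \<in> N2" for y
      using c split[of c y] z1[OF that, of c] that by simp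
    ultimately show "c x = 0"
      using x row_basis_indep[OF 1, of c x] row_basis_indep[OF 2, of c x] by blast
  next
    fix x assume x: "x \<in> M1 \<union> M2"
    show "\<exists>c. \<forall>y\<in>N1 \<union> N2. A x y = (\<Sum>b\<in>B1 \<union> B2. c b * A b y)"
    proof (cases "x \<in> M1")
      case True
      then obtain c where c: "\<And>y. y \<in> N1 \<Longrightarrow> A x y = (\<Sum>b\<in>B1. c b * A b y)"
        using 1 unfolding row_basis_def by blast
      \<comment> \<open>The coefficients are cut off outside \<open>B1\<close>, so that the other
        block contributes nothing.\<close>
      let ?c = "\<lambda>b. if b \<in> B1 then c b else 0"
      have e1: "(\<Sum>b\<in>B1. ?c b * A b y) = (\<Sum>b\<in>B1. c b * A b y)" for y by (rule sum.cong) auto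
      have e2: "(\<Sum>b\<in>B2. ?c b * A b y) = 0" for y by (rule sum.neutral) (use dB in auto)
      have "A x y = (\<Sum>b\<in>B1 \<union> B2. ?c b * A b y)" if "y \<in> N1 \<union> N2" for y
        unfolding split e1 e2 using c[of y] z1[of y c] zero(1)[OF True, of y] that by (cases "y \<in> N1") auto
      then show ?thesis by (intro exI[of _ ?c] ballI)
    next
      case False
      with x have x2: "x \<in> M2" by blast
      then obtain c where c: "\<And>y. y \<in> N2 \<Longrightarrow> A x y = (\<Sum>b\<in>B2. c b * A b y)"
        using 2 unfolding row_basis_def by blast
      let ?c = "\<lambda>b. if b \<in> B2 then c b else 0"
      have e1: "(\<Sum>b\<in>B2. ?c b * A b y) = (\<Sum>b\<in>B2. c b * A b y)" for y by (rule sum.cong) auto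
      have e2: "(\<Sum>b\<in>B1. ?c b * A b y) = 0" for y by (rule sum.neutral) (use dB in auto)
      have "A x y = (\<Sum>b\<in>B1 \<union> B2. ?c b * A b y)" if "y \<in> N1 \<union> N2" for y
        unfolding split e1 e2 using c[of y] z2[of y c] zero(2)[OF x2, of y] that by (cases "y \<in> N2") auto
      then show ?thesis by (intro exI[of _ ?c] ballI)
    qed
  qed (use fin sub in auto)
qed

text \<open>Each pair is a pivot (row, column). In list order the chosen rows and columns form an
  upper triangular matrix with nonzero diagonal; nothing is required above the diagonal, so the
  notion does not depend on the characteristic.\<close>

inductive triangular :: "('a \<Rightarrow> 'b \<Rightarrow> 'k::field) \<Rightarrow> ('a \<times> 'b) list \<Rightarrow> bool" for A where
  Nil: "triangular A []"
| Cons: "A x y \<noteq> 0 \<Longrightarrow> \<forall>p\<in>set ps. A (fst p) y = 0 \<Longrightarrow> triangular A ps \<Longrightarrow> triangular A ((x, y) # ps)"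

lemma triangular_nonzero: "triangular A ps \<Longrightarrow> p \<in> set ps \<Longrightarrow> A (fst p) (snd p) \<noteq> 0"
  by (induction rule: triangular.induct) auto

lemma triangular_distinct:
  assumes "triangular A ps"
  shows "distinct (map fst ps) \<and> distinct (map snd ps)"
  using assms by (induction rule: triangular.induct) (use triangular_nonzero in fastforce)+

lemma triangular_filter: "triangular A ps \<Longrightarrow> triangular A (filter P ps)"
  by (induction rule: triangular.induct) (simp_all add: triangular.Nil triangular.Cons)

lemma triangular_map:
  assumes "triangular A ps"
    and "\<And>p q. p \<in> set ps \<Longrightarrow> q \<in> set ps \<Longrightarrow> A' (f (fst p)) (g (snd q)) = A (fst p) (snd q)"
  shows "triangular A' (map (map_prod f g) ps)"
  using assms
proof (induction rule: triangular.induct)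
  case (Cons x y ps)
  have "A' (f x) (g y) = A x y" using Cons.prems[of "(x, y)" "(x, y)"] by simp
  moreover have "A' (f (fst p)) (g y) = 0" if "p \<in> set ps" for p
    using Cons.prems[of p "(x, y)"] Cons.hyps(2) that by simp
  ultimately show ?case
    using Cons by (auto intro!: triangular.Cons)
qed (simp add: triangular.Nil)

text \<open>Forward elimination: in the column of the head pivot only the head row is nonzero, so
  its coefficient vanishes, and the tail is treated in the same way.\<close>

lemma triangular_row_indep:
  assumes "triangular A ps" "\<And>p. p \<in> set ps \<Longrightarrow> (\<Sum>x\<in>fst ` set ps. c x * A x (snd p)) = 0"
    and "p \<in> set ps"
  shows "c (fst p) = 0"
  using assms
proof (induction arbitrary: p rule: triangular.induct)
  case (Cons x y ps)
  have x: "x \<notin> fst ` set ps" using Cons.hyps(1,2) by auto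
  have s: "(\<Sum>x\<in>fst ` set ((x, y) # ps). c x * A x y') = c x * A x y' + (\<Sum>x\<in>fst ` set ps. c x * A x y')" for y'
    using x by (simp add: sum.insert)
  have "(\<Sum>x\<in>fst ` set ps. c x * A x y) = 0"
    by (rule sum.neutral) (use Cons.hyps(2) in auto)
  with Cons.prems(1)[of "(x, y)"] s[of y] Cons.hyps(1) have cx: "c x = 0" by simp
  have "c (fst q) = 0" if "q \<in> set ps" for q
  proof (rule Cons.IH)
    fix p assume "p \<in> set ps"
    then show "(\<Sum>x\<in>fst ` set ps. c x * A x (snd p)) = 0"
      using Cons.prems(1)[of p] s[of "snd p"] cx by simp
  qed (use that in auto)
  with cx Cons.prems(2) show ?case by (metis fst_conv set_ConsD)
qed simp

text \<open>The order is opposite to that for rows: the head column is zero on all later rows, so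
  the tail is settled first and the head row then gives the head coefficient.\<close>

lemma triangular_col_indep:
  assumes "triangular A ps" "\<And>p. p \<in> set ps \<Longrightarrow> (\<Sum>y\<in>snd ` set ps. c y * A (fst p) y) = 0"
    and "p \<in> set ps"
  shows "c (snd p) = 0"
  using assms
proof (induction arbitrary: p rule: triangular.induct)
  case (Cons x y ps)
  have "distinct (map snd ((x, y) # ps))"
    using triangular_distinct[OF triangular.Cons[OF Cons.hyps]] by blast
  then have y: "y \<notin> snd ` set ps" by simp
  have s: "(\<Sum>y\<in>snd ` set ((x, y) # ps). c y * A x' y) = c y * A x' y + (\<Sum>y\<in>snd ` set ps. c y * A x' y)" for x'
    using y by (simp add: sum.insert)
  have *: "c (snd q) = 0" if "q \<in> set ps" for q
  proof (rule Cons.IH)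
    fix p assume p: "p \<in> set ps"
    then show "(\<Sum>y\<in>snd ` set ps. c y * A (fst p) y) = 0"
      using Cons.prems(1)[of p] s[of "fst p"] Cons.hyps(2) by simp
  qed (use that in auto)
  then have "(\<Sum>y\<in>snd ` set ps. c y * A x y) = 0"
    by (intro sum.neutral) auto
  with Cons.prems(1)[of "(x, y)"] s[of x] Cons.hyps(1) have "c y = 0" by simp
  with * Cons.prems(2) show ?case by (metis snd_conv set_ConsD)
qed simp

text \<open>Back substitution: once the tail is solved, the coefficient of the head column can be
  adjusted to fit the head row, since that column is zero on every other row.\<close>

lemma triangular_col_solve:
  assumes "triangular A ps"
  shows "\<exists>c. \<forall>p\<in>set ps. t (fst p) = (\<Sum>y\<in>snd ` set ps. c y * A (fst p) y)"
  using assms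
proof (induction rule: triangular.induct)
  case (Cons x y ps)
  have "distinct (map snd ((x, y) # ps))"
    using triangular_distinct[OF triangular.Cons[OF Cons.hyps]] by blast
  then have y: "y \<notin> snd ` set ps" by simp
  obtain c where c: "\<And>p. p \<in> set ps \<Longrightarrow> t (fst p) = (\<Sum>y\<in>snd ` set ps. c y * A (fst p) y)"
    using Cons.IH by blast
  define d where "d = (t x - (\<Sum>y\<in>snd ` set ps. c y * A x y)) / A x y"
  define c' where "c' = c(y := d)"
  have u: "(\<Sum>y'\<in>snd ` set ps. c' y' * A x' y') = (\<Sum>y\<in>snd ` set ps. c y * A x' y)" for x'
    by (rule sum.cong) (use y in \<open>auto simp: c'_def\<close>)
  have s: "(\<Sum>y'\<in>snd ` set ((x, y) # ps). c' y' * A x' y') =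
      d * A x' y + (\<Sum>y\<in>snd ` set ps. c y * A x' y)" for x'
    using y u[of x'] by (simp add: c'_def)
  have "t (fst p) = (\<Sum>y'\<in>snd ` set ((x, y) # ps). c' y' * A (fst p) y')" if "p \<in> set ((x, y) # ps)" for p
  proof (cases "p \<in> set ps")
    case True
    then show ?thesis unfolding s using c Cons.hyps(2) by simp
  next
    case False
    with that have "fst p = x" by auto
    then show ?thesis unfolding s using Cons.hyps(1) by (simp add: d_def)
  qed
  then show ?case by (intro exI[of _ c'] ballI)
qed simp

text \<open>If all rows without a pivot vanish, the number of pivots is the rank. For columns,
  \<open>triangular_col_solve\<close> matches any column on the pivot rows, and on the remaining
  rows both sides are 0.\<close>

lemma row_basis_triangular:
  assumes tri: "triangular A ps" and sub: "fst ` set ps \<subseteq> M" "snd ` set ps \<subseteq> N"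
    and zero: "\<And>x y. x \<in> M \<Longrightarrow> x \<notin> fst ` set ps \<Longrightarrow> y \<in> N \<Longrightarrow> A x y = 0"
  shows "row_basis A M N (fst ` set ps)"
    and "row_basis (\<lambda>y x. A x y) N M (snd ` set ps)"
    and "card (fst ` set ps) = length ps" "card (snd ` set ps) = length ps"
proof -
  show "row_basis A M N (fst ` set ps)" unfolding row_basis_def
  proof (intro conjI allI impI ballI)
    fix c x assume "\<forall>y\<in>N. (\<Sum>x\<in>fst ` set ps. c x * A x y) = 0" "x \<in> fst ` set ps"
    then show "c x = 0" using triangular_row_indep[OF tri, of c] sub(2) by blast
  next
    fix x assume x: "x \<in> M"
    show "\<exists>c. \<forall>y\<in>N. A x y = (\<Sum>b\<in>fst ` set ps. c b * A b y)"
    proof (cases "x \<in> fst ` set ps")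
      case True
      have "(\<Sum>b\<in>fst ` set ps. of_bool (b = x) * A b y) = A x y" for y
        using True by (simp add: of_bool_def if_distrib[of "\<lambda>z. z * _"] sum.delta' cong: if_cong)
      then show ?thesis by (intro exI[of _ "\<lambda>b. of_bool (b = x)"]) simp
    next
      case False
      then show ?thesis using zero x by (intro exI[of _ "\<lambda>_. 0"]) simp
    qed
  qed (use sub in auto)
  show "row_basis (\<lambda>y x. A x y) N M (snd ` set ps)" unfolding row_basis_def
  proof (intro conjI allI impI ballI)
    fix c y assume "\<forall>x\<in>M. (\<Sum>y\<in>snd ` set ps. c y * A x y) = 0" "y \<in> snd ` set ps"
    then show "c y = 0" using triangular_col_indep[OF tri, of c] sub(1) by blast
  next
    fix y assume y: "y \<in> N"
    obtain c where c: "\<And>p. p \<in> set ps \<Longrightarrow> A (fst p) y = (\<Sum>y\<in>snd ` set ps. c y * A (fst p) y)"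
      using triangular_col_solve[OF tri, of "\<lambda>x. A x y"] by blast
    have "A x y = (\<Sum>y\<in>snd ` set ps. c y * A x y)" if "x \<in> M" for x
    proof (cases "x \<in> fst ` set ps")
      case True then show ?thesis using c by blast
    next
      case False
      then have "A x y' = 0" if "y' \<in> N" for y' using zero \<open>x \<in> M\<close> that by blast
      moreover have "(\<Sum>y\<in>snd ` set ps. c y * A x y) = 0"
        by (rule sum.neutral) (use calculation sub in auto)
      ultimately show ?thesis using y by simp
    qed
    then show "\<exists>c. \<forall>x\<in>M. A x y = (\<Sum>b\<in>snd ` set ps. c b * A x b)" by blast
  qed (use sub in auto)
  show "card (fst ` set ps) = length ps" "card (snd ` set ps) = length ps"
    using triangular_distinct[OF tri] distinct_card[of "map fst ps"] distinct_card[of "map snd ps"] by auto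
qed

text \<open>Executable form of the elimination. The unknowns are the coefficients of the rows, each
  column is an equation, and \<open>rows\<close> and \<open>cols\<close> list the nonzero positions.
  An unknown is found to vanish within \<open>n\<close> rounds if some equation contains, besides
  it, only unknowns found within \<open>n - 1\<close> rounds.\<close>

fun solvable :: "('b \<Rightarrow> 'a list) \<Rightarrow> ('a \<Rightarrow> 'b list) \<Rightarrow> nat \<Rightarrow> 'a \<Rightarrow> bool" where
  "solvable rows cols 0 x \<longleftrightarrow> False"
| "solvable rows cols (Suc n) x \<longleftrightarrow>
     list_ex (\<lambda>y. list_all (\<lambda>x'. x' = x \<or> solvable rows cols n x') (rows y)) (cols x)"

text \<open>A row of least level goes to the head of the list: any other row that is nonzero in its
  column would have a smaller level.\<close>

lemma triangular_of_levels:
  fixes level :: "'a \<Rightarrow> nat"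
  assumes "finite U" "\<And>x. x \<in> U \<Longrightarrow> A x (f x) \<noteq> 0"
    and "\<And>x x'. x \<in> U \<Longrightarrow> x' \<in> U \<Longrightarrow> x' \<noteq> x \<Longrightarrow> A x' (f x) \<noteq> 0 \<Longrightarrow> level x' < level x"
  shows "\<exists>ps. triangular A ps \<and> fst ` set ps = U"
  using assms
proof (induction "card U" arbitrary: U)
  case 0
  then show ?case by (intro exI[of _ "[]"]) (simp add: triangular.Nil)
next
  case (Suc n)
  then have "U \<noteq> {}" by auto
  then obtain x where x: "x \<in> U" "\<And>x'. x' \<in> U \<Longrightarrow> level x \<le> level x'"
    using ex_has_least_nat[of "\<lambda>x. x \<in> U" _ level] by blast
  have "n = card (U - {x})" using Suc.hyps(2) Suc.prems(1) x(1) by simp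
  then obtain ps where ps: "triangular A ps" "fst ` set ps = U - {x}"
    using Suc.hyps(1)[of "U - {x}"] Suc.prems by auto
  have "A x' (f x) = 0" if "x' \<in> U - {x}" for x'
    using Suc.prems(3)[of x x'] x(1) x(2)[of x'] that by auto
  then have "\<forall>p\<in>set ps. A (fst p) (f x) = 0" using ps(2) by (metis imageI)
  then have "triangular A ((x, f x) # ps)"
    by (rule triangular.Cons[OF Suc.prems(2)[OF x(1)] _ ps(1)])
  moreover have "fst ` set ((x, f x) # ps) = U" using ps(2) x(1) by auto
  ultimately show ?case by blast
qed

text \<open>The level of a row is the first round in which its coefficient is found to vanish; the
  other unknowns of the equation used have been found earlier.\<close>

lemma triangular_of_solvable:
  assumes A: "\<And>x y. A x y \<noteq> 0 \<longleftrightarrow> x \<in> set (rows y)" "\<And>x y. A x y \<noteq> 0 \<longleftrightarrow> y \<in> set (cols x)"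
    and U: "list_all (solvable rows cols n) U"
  shows "\<exists>ps. triangular A ps \<and> fst ` set ps = set U"
proof -
  define level where "level x = (LEAST k. solvable rows cols k x)" for x
  have "\<exists>y. A x y \<noteq> 0 \<and> (\<forall>x'. x' \<noteq> x \<longrightarrow> A x' y \<noteq> 0 \<longrightarrow> level x' < level x)" if "x \<in> set U" for x
  proof -
    have "solvable rows cols (level x) x"
      unfolding level_def by (rule LeastI[of _ n]) (use U that in \<open>simp add: list_all_iff\<close>)
    moreover from this obtain k where k: "level x = Suc k" by (cases "level x") auto
    ultimately obtain y where y: "y \<in> set (cols x)" "\<forall>x'\<in>set (rows y). x' = x \<or> solvable rows cols k x'"
      by (auto simp: list_ex_iff list_all_iff)
    have "level x' < level x" if "x' \<noteq> x" "A x' y \<noteq> 0" for x'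
      using y(2) that A(1) Least_le[of "\<lambda>k. solvable rows cols k x'" k] k unfolding level_def by fastforce
    then show ?thesis using y(1) A(2) by blast
  qed
  then obtain f where "\<And>x. x \<in> set U \<Longrightarrow> A x (f x) \<noteq> 0"
      "\<And>x x'. x \<in> set U \<Longrightarrow> x' \<noteq> x \<Longrightarrow> A x' (f x) \<noteq> 0 \<Longrightarrow> level x' < level x"
    by metis
  then show ?thesis by (intro triangular_of_levels) auto
qed

section \<open>Quotients of polynomial rings\<close>

lemma mpoly_ring_simps [simp]:
  "x \<otimes>\<^bsub>mpoly_ring r\<^esub> y = x * y" "x \<oplus>\<^bsub>mpoly_ring r\<^esub> y = x + y"
  "\<zero>\<^bsub>mpoly_ring r\<^esub> = 0" "\<one>\<^bsub>mpoly_ring r\<^esub> = 1"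
  by (simp_all add: mpoly_ring_def)

abbreviation vmonomials :: "nat \<Rightarrow> (nat \<Rightarrow>\<^sub>0 nat) set" where
  "vmonomials r \<equiv> {m. Poly_Mapping.keys m \<subseteq> {..<r}}"

definition monomials :: "nat \<Rightarrow> nat \<Rightarrow> (nat \<Rightarrow>\<^sub>0 nat) set" where
  "monomials r d = {m \<in> vmonomials r. mon_degree m = d}"

lemma mpoly_carrier: "p \<in> carrier (mpoly_ring r) \<longleftrightarrow> Poly_Mapping.keys p \<subseteq> vmonomials r"
  by (auto simp: mpoly_ring_def)

lemma forms_iff: "p \<in> forms r d \<longleftrightarrow> Poly_Mapping.keys p \<subseteq> monomials r d"
  by (auto simp: forms_def mpoly_carrier monomials_def)

lemma mpoly_carrier_uminus: "p \<in> carrier (mpoly_ring r) \<Longrightarrow> - p \<in> carrier (mpoly_ring r)"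
  by (simp add: mpoly_carrier)

lemma mpoly_carrier_add:
  "p \<in> carrier (mpoly_ring r) \<Longrightarrow> q \<in> carrier (mpoly_ring r) \<Longrightarrow> p + q \<in> carrier (mpoly_ring r)"
  using ring.ring_simprules(1)[OF cring.axioms(1)[OF cring_mpoly_ring], of p r q] by simp

lemma mpoly_carrier_mult:
  "p \<in> carrier (mpoly_ring r) \<Longrightarrow> q \<in> carrier (mpoly_ring r) \<Longrightarrow> p * q \<in> carrier (mpoly_ring r)"
  using ring.ring_simprules(5)[OF cring.axioms(1)[OF cring_mpoly_ring], of p r q] by simp

lemma mpoly_carrier_diff:
  "p \<in> carrier (mpoly_ring r) \<Longrightarrow> q \<in> carrier (mpoly_ring r) \<Longrightarrow> p - q \<in> carrier (mpoly_ring r)"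
  using mpoly_carrier_add[OF _ mpoly_carrier_uminus, of p r q] by simp

lemma mpoly_a_inv: "p \<in> carrier (mpoly_ring r) \<Longrightarrow> \<ominus>\<^bsub>mpoly_ring r\<^esub> p = - p"
proof -
  interpret cring "mpoly_ring r :: 'a mpoly ring" by (rule cring_mpoly_ring)
  assume "p \<in> carrier (mpoly_ring r)"
  then show ?thesis using minus_equality[of "- p" p] mpoly_carrier_uminus[of p r] by simp
qed

lemma mpoly_a_minus:
  "p \<in> carrier (mpoly_ring r) \<Longrightarrow> q \<in> carrier (mpoly_ring r) \<Longrightarrow> p \<ominus>\<^bsub>mpoly_ring r\<^esub> q = p - q"
  by (simp add: a_minus_def mpoly_a_inv)

lemma mpoly_const_simps:
  "mpoly_const a * mpoly_const b = mpoly_const (a * b)"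
  "mpoly_const a + mpoly_const b = mpoly_const (a + b)"
  "- mpoly_const a = mpoly_const (- a)"
  "mpoly_const 0 = 0" "mpoly_const 1 = 1"
  by (simp_all add: mpoly_const_def mult_single single_add single_uminus)

lemma mpoly_const_carrier [simp]: "mpoly_const c \<in> carrier (mpoly_ring r)"
  by (simp add: mpoly_carrier mpoly_const_def)

lemma mpoly_const_mult_single: "mpoly_const c * Poly_Mapping.single m a = Poly_Mapping.single m (c * a)"
  by (simp add: mpoly_const_def mult_single)

lemma subfield_mpoly_const: "subfield (Set.range mpoly_const) (mpoly_ring r :: 'k::field mpoly ring)"
proof -
  interpret cring "mpoly_ring r :: 'k mpoly ring" by (rule cring_mpoly_ring)
  let ?K = "Set.range mpoly_const :: 'k mpoly set"
  show ?thesis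
  proof (rule subfieldI)
    show "subcring ?K (mpoly_ring r)"
      by (intro subcringI' subringI)
        (auto simp: mpoly_a_inv mpoly_const_simps intro: range_eqI[of _ _ 1])
    have "mpoly_const a \<in> Units ((mpoly_ring r)\<lparr>carrier := ?K\<rparr>)" if "a \<noteq> 0" for a :: 'k
      unfolding Units_def using that
      by (auto intro!: exI[of _ "inverse a"] simp: mpoly_const_simps)
    moreover have "0 \<notin> Units ((mpoly_ring r)\<lparr>carrier := ?K\<rparr>)"
      by (auto simp: Units_def)
    ultimately show "Units ((mpoly_ring r)\<lparr>carrier := ?K\<rparr>) = ?K - {\<zero>\<^bsub>mpoly_ring r\<^esub>}"
      by (auto simp: Units_def mpoly_const_simps) (metis mpoly_const_simps(4))
  qed
qed

lemma mon_degree_superset: "finite V \<Longrightarrow> Poly_Mapping.keys m \<subseteq> V \<Longrightarrow> mon_degree m = (\<Sum>i\<in>V. Poly_Mapping.lookup m i)"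
  unfolding mon_degree_def by (rule sum.mono_neutral_left) (auto simp: in_keys_iff)

lemma mon_degree_add: "mon_degree (m + n) = mon_degree m + mon_degree n"
proof -
  let ?V = "Poly_Mapping.keys m \<union> Poly_Mapping.keys n"
  have "mon_degree (m + n) = (\<Sum>i\<in>?V. Poly_Mapping.lookup (m + n) i)"
    by (rule mon_degree_superset) (use keys_add[of m n] in auto)
  then show ?thesis
    using mon_degree_superset[of ?V m] mon_degree_superset[of ?V n] by (simp add: lookup_add sum.distrib)
qed

lemma mon_degree_single [simp]: "mon_degree (Poly_Mapping.single i a) = a"
  by (simp add: mon_degree_def)

lemma mon_degree_0 [simp]: "mon_degree 0 = 0"
  by (simp add: mon_degree_def)

lemma mon_degree_eq_0 [simp]: "mon_degree m = 0 \<longleftrightarrow> m = 0"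
  by (auto simp: mon_degree_def in_keys_iff intro: poly_mapping_eqI)

lemma keys_monomial_add: "Poly_Mapping.keys (m + n) = Poly_Mapping.keys m \<union> Poly_Mapping.keys (n :: nat \<Rightarrow>\<^sub>0 nat)"
  by (auto simp: in_keys_iff lookup_add)

lemma poly_mapping_sum_single:
  assumes "finite K" "Poly_Mapping.keys p \<subseteq> K"
  shows "p = (\<Sum>m\<in>K. Poly_Mapping.single m (Poly_Mapping.lookup p m))"
proof (rule poly_mapping_eqI)
  fix k
  show "Poly_Mapping.lookup p k = Poly_Mapping.lookup (\<Sum>m\<in>K. Poly_Mapping.single m (Poly_Mapping.lookup p m)) k"
    using assms by (auto simp: lookup_sum lookup_single when_def in_keys_iff)
qed

section \<open>Linear algebra over k in the quotient by a proper ideal\<close>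

locale proper_mpoly_ideal =
  fixes r :: nat and I :: "'k::field mpoly set"
  assumes ideal_I: "ideal I (mpoly_ring r)" and proper_I: "I \<noteq> carrier (mpoly_ring r)"
begin

sublocale R: cring "mpoly_ring r :: 'k mpoly ring" by (rule cring_mpoly_ring)
sublocale I: ideal I "mpoly_ring r" by (rule ideal_I)
sublocale Q: cring "quot_alg r I" unfolding quot_alg_def by (rule I.quotient_is_cring[OF cring_mpoly_ring])
sublocale h: ring_hom_ring "mpoly_ring r" "quot_alg r I" "residue_class r I"
  unfolding quot_alg_def residue_class_def using I.rcos_ring_hom_ring by (simp add: eta_contract_eq)

lemma residue_eq_iff:
  assumes "p \<in> carrier (mpoly_ring r)" "q \<in> carrier (mpoly_ring r)"
  shows "residue_class r I p = residue_class r I q \<longleftrightarrow> p - q \<in> I"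
  using R.quotient_eq_iff_same_a_r_cos[OF ideal_I assms] assms
  by (simp add: residue_class_def mpoly_a_minus)

lemma residue_0_iff:
  assumes "p \<in> carrier (mpoly_ring r)"
  shows "residue_class r I p = \<zero>\<^bsub>quot_alg r I\<^esub> \<longleftrightarrow> p \<in> I"
  using residue_eq_iff[OF assms, of 0] h.hom_zero R.zero_closed by simp

lemma I_carrier: "p \<in> I \<Longrightarrow> p \<in> carrier (mpoly_ring r)"
  by (rule I.a_Hcarr)

lemma I_add: "p \<in> I \<Longrightarrow> q \<in> I \<Longrightarrow> p + q \<in> I"
  using I.a_closed[of p q] by simp

lemma I_mult: "p \<in> carrier (mpoly_ring r) \<Longrightarrow> q \<in> I \<Longrightarrow> p * q \<in> I"
  using I.I_l_closed[of q p] by simp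

lemma I_zero: "0 \<in> I" using I.zero_closed by simp

lemma I_sum: "(\<And>x. x \<in> M \<Longrightarrow> f x \<in> I) \<Longrightarrow> sum f M \<in> I"
  by (induction M rule: infinite_finite_induct) (auto simp: I_zero I_add)

lemma one_notin_I: "1 \<notin> I"
  using proper_I I.one_imp_carrier by auto

lemma quot_carrier: "carrier (quot_alg r I) = residue_class r I ` carrier (mpoly_ring r)"
  unfolding quot_alg_def residue_class_def FactRing_def A_RCOSETS_def' by auto

lemma subfield_scalars: "subfield (scalars r I) (quot_alg r I)"
  unfolding scalars_def
proof (rule h.img_is_subfield(2)[OF subfield_mpoly_const])
  show "\<one>\<^bsub>quot_alg r I\<^esub> \<noteq> \<zero>\<^bsub>quot_alg r I\<^esub>"
    using residue_0_iff[OF R.one_closed] one_notin_I h.hom_one by simp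
qed

lemma hilb_eqI: "Q.dimension n (scalars r I) (graded_piece r I d) \<Longrightarrow> hilb r I d = n"
  using Q.dimI[OF subfield_scalars] unfolding hilb_def over_def by blast

text \<open>Translates linear algebra in the quotient ring into conditions on the supports of
  polynomials; all dimension counts rest on it.\<close>

lemma Span_residue:
  assumes "set ms \<subseteq> vmonomials r"
  shows "Q.Span (scalars r I) (map (\<lambda>m. residue_class r I (Poly_Mapping.single m 1)) ms) =
    residue_class r I ` {p. Poly_Mapping.keys p \<subseteq> set ms}"
  using assms
proof (induction ms)
  case Nil
  have "{p :: 'k mpoly. Poly_Mapping.keys p \<subseteq> {}} = {0}" by auto
  then show ?case using h.hom_zero by simp
next
  case (Cons m ms)
  let ?res = "residue_class r I" and ?s = "\<lambda>m a. Poly_Mapping.single m a :: 'k mpoly"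
  have c: "?s m a \<in> carrier (mpoly_ring r)" for a using Cons.prems by (simp add: mpoly_carrier)
  have lin: "?res (mpoly_const a) \<otimes>\<^bsub>quot_alg r I\<^esub> ?res (?s m 1) \<oplus>\<^bsub>quot_alg r I\<^esub> ?res p = ?res (?s m a + p)"
    if "p \<in> carrier (mpoly_ring r)" for a p
    using that c h.hom_mult[OF mpoly_const_carrier c, of a 1] h.hom_add[OF c that, of a]
    by (simp add: mpoly_const_mult_single)
  have "Q.Span (scalars r I) (map (\<lambda>m. ?res (?s m 1)) (m # ms)) =
      Q.line_extension (scalars r I) (?res (?s m 1)) (?res ` {p. Poly_Mapping.keys p \<subseteq> set ms})"
    using Cons by simp
  also have "\<dots> = ?res ` {p. Poly_Mapping.keys p \<subseteq> set (m # ms)}" (is "?L = ?R")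
  proof (intro equalityI subsetI)
    fix u assume "u \<in> ?L"
    then obtain a p where p: "Poly_Mapping.keys p \<subseteq> set ms"
      and u: "u = ?res (mpoly_const a) \<otimes>\<^bsub>quot_alg r I\<^esub> ?res (?s m 1) \<oplus>\<^bsub>quot_alg r I\<^esub> ?res p"
      by (auto simp: Q.line_extension_mem_iff scalars_def)
    have "u = ?res (?s m a + p)" unfolding u by (rule lin) (use p Cons.prems in \<open>auto simp: mpoly_carrier\<close>)
    moreover have "Poly_Mapping.keys (?s m a + p) \<subseteq> set (m # ms)"
      using keys_add[of "?s m a" p] p by (auto split: if_splits)
    ultimately show "u \<in> ?R" by blast
  next
    fix u assume "u \<in> ?R"
    then obtain p where p: "Poly_Mapping.keys p \<subseteq> set (m # ms)" "u = ?res p" by blast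
    let ?a = "Poly_Mapping.lookup p m" and ?q = "p - ?s m (Poly_Mapping.lookup p m)"
    have "Poly_Mapping.keys ?q \<subseteq> set ms"
      using p(1) by (auto simp: in_keys_iff lookup_minus lookup_single when_def split: if_splits)
    moreover have "u = ?res (mpoly_const ?a) \<otimes>\<^bsub>quot_alg r I\<^esub> ?res (?s m 1) \<oplus>\<^bsub>quot_alg r I\<^esub> ?res ?q"
      using calculation Cons.prems p by (subst lin) (auto simp: mpoly_carrier)
    ultimately show "u \<in> ?L" by (auto simp: Q.line_extension_mem_iff scalars_def)
  qed
  finally show ?case .
qed

text \<open>A linear relation between the classes of monomials in \<open>B\<close> is a nonzero
  polynomial supported on \<open>B\<close> that lies in \<open>I\<close>.\<close>

lemma dimension_residue:
  assumes "finite B" "B \<subseteq> vmonomials r"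
    and indep: "\<And>p. p \<in> I \<Longrightarrow> Poly_Mapping.keys p \<subseteq> B \<Longrightarrow> p = 0"
  shows "Q.dimension (card B) (scalars r I) (residue_class r I ` {p. Poly_Mapping.keys p \<subseteq> B})"
proof -
  obtain ms where ms: "set ms = B" "distinct ms" using finite_distinct_list[OF assms(1)] by blast
  let ?u = "\<lambda>m. residue_class r I (Poly_Mapping.single m 1)"
  have "Q.independent (scalars r I) (map ?u ms)"
    using ms(2) equalityD1[OF ms(1)]
  proof (induction ms)
    case (Cons m ms)
    have m: "Poly_Mapping.single m 1 \<in> carrier (mpoly_ring r)"
      using Cons.prems assms(2) by (auto simp: mpoly_carrier)
    have "?u m \<notin> Q.Span (scalars r I) (map ?u ms)"
    proof
      assume "?u m \<in> Q.Span (scalars r I) (map ?u ms)"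
      then obtain p where p: "Poly_Mapping.keys p \<subseteq> set ms" "?u m = residue_class r I p"
        using Span_residue[of ms] Cons.prems assms(2) by auto
      have pc: "p \<in> carrier (mpoly_ring r)" using p(1) Cons.prems assms(2) by (auto simp: mpoly_carrier)
      have "Poly_Mapping.single m 1 - p \<in> I" using residue_eq_iff[OF m pc] p(2) by simp
      moreover have "Poly_Mapping.keys (Poly_Mapping.single m 1 - p) \<subseteq> B"
        using p(1) Cons.prems keys_diff[of "Poly_Mapping.single m 1" p] by auto
      ultimately have "Poly_Mapping.single m 1 = p" using indep by fastforce
      then show False using p(1) Cons.prems(1) by auto
    qed
    moreover have "?u m \<in> carrier (quot_alg r I)" using h.hom_closed[OF m] .
    ultimately show ?case using Cons by (simp add: Q.li_Cons)
  qed simp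
  from Q.dimension_independent[OF this] show ?thesis
    using Span_residue[of ms] ms assms(2) distinct_card[OF ms(2)] by simp
qed

end

section \<open>Graded pieces of a standard graded algebra\<close>

context proper_mpoly_ideal
begin

text \<open>Here \<open>subalgebra\<close> means a linear subspace. This is what lets a graded piece
  inherit finite dimension from the whole quotient.\<close>

lemma subalgebra_graded_piece: "subalgebra (scalars r I) (graded_piece r I d) (quot_alg r I)"
proof -
  have form: "p \<in> carrier (mpoly_ring r)" if "p \<in> forms r d" for p :: "'k mpoly"
    using that by (simp add: forms_def)
  have add: "p + q \<in> forms r d" if "p \<in> forms r d" "q \<in> forms r d" for p q :: "'k mpoly"
    using that keys_add[of p q] by (auto simp: forms_iff)
  have "subgroup (graded_piece r I d) (add_monoid (quot_alg r I))"
  proof (rule Q.add.subgroupI)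
    show "graded_piece r I d \<subseteq> carrier (quot_alg r I)"
      unfolding graded_piece_def using form h.hom_closed by blast
    have "0 \<in> forms r d" by (simp add: forms_iff)
    then show "graded_piece r I d \<noteq> {}" unfolding graded_piece_def by blast
  next
    fix a assume "a \<in> graded_piece r I d"
    then obtain p where p: "p \<in> forms r d" "a = residue_class r I p" unfolding graded_piece_def by blast
    then have "\<ominus>\<^bsub>quot_alg r I\<^esub> a = residue_class r I (- p)"
      using h.hom_a_inv[OF form] mpoly_a_inv[OF form] by simp
    moreover have "- p \<in> forms r d" using p(1) by (simp add: forms_iff)
    ultimately show "\<ominus>\<^bsub>quot_alg r I\<^esub> a \<in> graded_piece r I d" unfolding graded_piece_def by blast
  next
    fix a b assume "a \<in> graded_piece r I d" "b \<in> graded_piece r I d"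
    then obtain p q where pq: "p \<in> forms r d" "a = residue_class r I p" "q \<in> forms r d" "b = residue_class r I q"
      unfolding graded_piece_def by blast
    then have "a \<oplus>\<^bsub>quot_alg r I\<^esub> b = residue_class r I (p + q)"
      using h.hom_add[OF form form, of p q] by simp
    then show "a \<oplus>\<^bsub>quot_alg r I\<^esub> b \<in> graded_piece r I d"
      unfolding graded_piece_def using add pq by blast
  qed
  moreover have "k \<otimes>\<^bsub>quot_alg r I\<^esub> a \<in> graded_piece r I d"
    if "k \<in> scalars r I" "a \<in> graded_piece r I d" for k a
  proof -
    obtain c p where cp: "k = residue_class r I (mpoly_const c)" "p \<in> forms r d" "a = residue_class r I p"
      using \<open>k \<in> scalars r I\<close> \<open>a \<in> graded_piece r I d\<close> unfolding scalars_def graded_piece_def by blast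
    then have "k \<otimes>\<^bsub>quot_alg r I\<^esub> a = residue_class r I (mpoly_const c * p)"
      using h.hom_mult[OF mpoly_const_carrier form] by simp
    moreover have "mpoly_const c * p \<in> forms r d"
      using cp(2) keys_mult[of "mpoly_const c" p]
      by (auto simp: forms_iff mpoly_const_def split: if_splits)
    ultimately show ?thesis unfolding graded_piece_def by blast
  qed
  ultimately show ?thesis by (simp add: subalgebra_def subalgebra_axioms_def)
qed

text \<open>A monomial of degree \<open>d + 1\<close> is a variable times a monomial of degree
  \<open>d\<close>, so it lies in \<open>I\<close> once all forms of degree \<open>d\<close> do.
  Finite dimension ensures that the value 0 of \<open>hilb\<close> really means a zero
  piece.\<close>

lemma hilb_Suc_eq_0:
  assumes fin: "Q.finite_dimension (scalars r I) (carrier (quot_alg r I))" and zero: "hilb r I d = 0"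
  shows "hilb r I (Suc d) = 0"
proof -
  have "Q.finite_dimension (scalars r I) (graded_piece r I d)"
    using Q.subalbegra_incl_imp_finite_dimension[OF subfield_scalars fin subalgebra_graded_piece]
      Q.subalgebra_in_carrier[OF subalgebra_graded_piece] by blast
  then obtain n where n: "Q.dimension n (scalars r I) (graded_piece r I d)" by blast
  then have "n = 0" using hilb_eqI zero by metis
  with n have piece: "graded_piece r I d = {\<zero>\<^bsub>quot_alg r I\<^esub>}" using Q.dimension_zero[OF subfield_scalars] by blast
  have form: "p \<in> I" if "p \<in> forms r d" for p
  proof -
    have "residue_class r I p = \<zero>\<^bsub>quot_alg r I\<^esub>" using piece that unfolding graded_piece_def by blast
    then show ?thesis using residue_0_iff[of p] that by (simp add: forms_def)
  qed
  have mono: "Poly_Mapping.single m c \<in> I" if m: "m \<in> monomials r (Suc d)" for m c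
  proof -
    have "m \<noteq> 0" using m by (auto simp: monomials_def)
    then obtain i where i: "i \<in> Poly_Mapping.keys m" by (metis all_not_in_conv keys_eq_empty)
    define n where "n = m - Poly_Mapping.single i 1"
    have mn: "m = Poly_Mapping.single i 1 + n"
      by (rule poly_mapping_eqI)
        (use i in \<open>auto simp: n_def lookup_add lookup_minus lookup_single when_def in_keys_iff\<close>)
    have "n \<in> monomials r d"
      using m unfolding mn by (auto simp: monomials_def mon_degree_add keys_monomial_add)
    then have "Poly_Mapping.single n c \<in> I" by (intro form) (auto simp: forms_iff)
    moreover have "Poly_Mapping.single (Poly_Mapping.single i 1) 1 \<in> carrier (mpoly_ring r)"
      using i m by (auto simp: mpoly_carrier monomials_def)
    ultimately have "Poly_Mapping.single (Poly_Mapping.single i 1) 1 * Poly_Mapping.single n c \<in> I"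
      by (rule I_mult[rotated])
    then show ?thesis by (simp only: mult_single mn mult_1)
  qed
  have "p \<in> I" if "p \<in> forms r (Suc d)" for p
  proof -
    have "(\<Sum>m\<in>Poly_Mapping.keys p. Poly_Mapping.single m (Poly_Mapping.lookup p m)) \<in> I"
      by (rule I_sum) (use that mono in \<open>auto simp: forms_iff\<close>)
    then show ?thesis using poly_mapping_sum_single[of "Poly_Mapping.keys p" p] by simp
  qed
  then have "residue_class r I p = \<zero>\<^bsub>quot_alg r I\<^esub>" if "p \<in> forms r (Suc d)" for p
    using residue_0_iff[of p] that by (simp add: forms_def)
  moreover have "0 \<in> forms r (Suc d)" by (simp add: forms_iff)
  ultimately have "graded_piece r I (Suc d) = {\<zero>\<^bsub>quot_alg r I\<^esub>}"
    unfolding graded_piece_def by force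
  then show ?thesis by (intro hilb_eqI) simp
qed

end

section \<open>The obstruction to being an SI-sequence\<close>

lemma artinian_h_vector_zero_step:
  assumes "artinian_h_vector TYPE('k::field) g" "Suc i < length g" "g ! i = 0"
  shows "g ! Suc i = 0"
proof -
  obtain r and I :: "'k mpoly set" where I: "standard_graded_artinian r I" "g = h_vector r I"
    using assms(1) unfolding artinian_h_vector_def by blast
  then interpret proper_mpoly_ideal r I
    by (intro proper_mpoly_ideal.intro) (auto simp: standard_graded_artinian_def homogeneous_ideal_def)
  have "hilb r I i = 0" using assms(2,3) I(2) by (simp add: h_vector_def del: upt_Suc)
  then have "hilb r I (Suc i) = 0"
    using I(1) by (intro hilb_Suc_eq_0) (simp add: standard_graded_artinian_def)
  then show ?thesis using assms(2) I(2) by (simp add: h_vector_def del: upt_Suc)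
qed

text \<open>The first half ends at index \<open>Suc i\<close>, and its difference sequence ends with
  a 0 followed by a positive entry, which \<open>artinian_h_vector_zero_step\<close>
  forbids.\<close>

lemma not_SI_sequence:
  assumes "Suc i = (length h - 1) div 2" "1 \<le> i" "h ! i = h ! (i - 1)" "h ! i < h ! Suc i"
  shows "\<not> SI_sequence TYPE('k::field) h"
proof
  let ?h = "take (Suc (Suc i)) h"
  assume "SI_sequence TYPE('k) h"
  then obtain g where g: "artinian_h_vector TYPE('k) g"
    "strip_while (\<lambda>d. d = 0) (first_difference ?h) = map int g"
    using assms(1)[symmetric] unfolding SI_sequence_def differentiable_seq_def by auto
  have len: "length ?h = Suc (Suc i)" using assms(1) by auto
  have nth: "first_difference ?h ! Suc i = int (h ! Suc i) - int (h ! i)"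
    "first_difference ?h ! i = int (h ! i) - int (h ! (i - 1))"
    using len assms(2) by (simp_all add: first_difference_def del: upt_Suc)
  have len': "length (first_difference ?h) = Suc (Suc i)" using len by (simp add: first_difference_def)
  then have "last (first_difference ?h) = first_difference ?h ! Suc i"
    by (metis diff_Suc_1 last_conv_nth length_0_conv nat.distinct(1))
  \<comment> \<open>As the last difference is nonzero, no trailing zeros are discarded and
    \<open>g\<close> still has the index \<open>Suc i\<close>.\<close>
  then have "last (first_difference ?h) \<noteq> 0" using nth(1) assms(4) by simp
  then have "strip_while (\<lambda>d. d = 0) (first_difference ?h) = first_difference ?h"
    by (intro strip_while_idem) (simp add: no_trailing_unfold)
  with g(2) have fd: "first_difference ?h = map int g" by simp
  then have lg: "length g = Suc (Suc i)" using len' by simp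
  have "int (g ! i) = 0" "int (g ! Suc i) \<noteq> 0"
    using nth assms(3,4) lg unfolding fd by simp_all
  with artinian_h_vector_zero_step[OF g(1), of i] lg show False by simp
qed

section \<open>Apolar algebras\<close>

text \<open>Think of \<open>\<phi>\<close> as the coefficient function of a dual form F. The value
  is then the coefficient of \<open>n\<close> in the contraction of F by \<open>p\<close>, so
  \<open>apolar_ideal\<close> is the annihilator of F.\<close>

definition apolar_pairing :: "((nat \<Rightarrow>\<^sub>0 nat) \<Rightarrow> 'k::field) \<Rightarrow> 'k mpoly \<Rightarrow> (nat \<Rightarrow>\<^sub>0 nat) \<Rightarrow> 'k" where
  "apolar_pairing \<phi> p n = (\<Sum>m\<in>Poly_Mapping.keys p. Poly_Mapping.lookup p m * \<phi> (m + n))"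

definition apolar_ideal :: "nat \<Rightarrow> ((nat \<Rightarrow>\<^sub>0 nat) \<Rightarrow> 'k::field) \<Rightarrow> 'k mpoly set" where
  "apolar_ideal r \<phi> = {p \<in> carrier (mpoly_ring r). \<forall>n\<in>vmonomials r. apolar_pairing \<phi> p n = 0}"

lemma apolar_pairing_superset:
  assumes "finite K" "Poly_Mapping.keys p \<subseteq> K"
  shows "apolar_pairing \<phi> p n = (\<Sum>m\<in>K. Poly_Mapping.lookup p m * \<phi> (m + n))"
  unfolding apolar_pairing_def using assms by (intro sum.mono_neutral_left) (auto simp: in_keys_iff)

lemma apolar_pairing_add: "apolar_pairing \<phi> (p + q) n = apolar_pairing \<phi> p n + apolar_pairing \<phi> q n"
proof -
  let ?K = "Poly_Mapping.keys p \<union> Poly_Mapping.keys q"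
  show ?thesis
    using keys_add[of p q] apolar_pairing_superset[of ?K p \<phi> n] apolar_pairing_superset[of ?K q \<phi> n]
      apolar_pairing_superset[of ?K "p + q" \<phi> n]
    by (simp add: lookup_add algebra_simps sum.distrib)
qed

lemma apolar_pairing_0 [simp]: "apolar_pairing \<phi> 0 n = 0"
  by (simp add: apolar_pairing_def)

lemma apolar_pairing_uminus: "apolar_pairing \<phi> (- p) n = - apolar_pairing \<phi> p n"
  using apolar_pairing_add[of \<phi> p "- p" n] by (simp add: add_eq_0_iff)

lemma apolar_pairing_diff: "apolar_pairing \<phi> (p - q) n = apolar_pairing \<phi> p n - apolar_pairing \<phi> q n"
  using apolar_pairing_add[of \<phi> p "- q" n] by (simp add: apolar_pairing_uminus)

lemma apolar_pairing_sum: "apolar_pairing \<phi> (sum f K) n = (\<Sum>i\<in>K. apolar_pairing \<phi> (f i) n)"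
  by (induction K rule: infinite_finite_induct) (auto simp: apolar_pairing_add)

lemma apolar_pairing_single: "apolar_pairing \<phi> (Poly_Mapping.single m c) n = c * \<phi> (m + n)"
  by (cases "c = 0") (auto simp: apolar_pairing_def)

lemma apolar_pairing_mult_single:
  "apolar_pairing \<phi> (Poly_Mapping.single m c * p) n = c * apolar_pairing \<phi> p (m + n)"
proof -
  have "Poly_Mapping.single m c * p =
      (\<Sum>k\<in>Poly_Mapping.keys p. Poly_Mapping.single (m + k) (c * Poly_Mapping.lookup p k))"
    by (subst (1) poly_mapping_sum_single[of "Poly_Mapping.keys p" p]) (auto simp: sum_distrib_left mult_single)
  then show ?thesis
    by (simp add: apolar_pairing_sum apolar_pairing_single sum_distrib_left ac_simps)
       (simp add: apolar_pairing_def sum_distrib_left ac_simps)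
qed

lemma lookup_homogeneous_component:
  "Poly_Mapping.lookup (homogeneous_component d p) m = (if mon_degree m = d then Poly_Mapping.lookup p m else 0)"
  unfolding homogeneous_component_def lookup_sum lookup_single
  by (auto simp: when_def in_keys_iff)

lemma keys_homogeneous_component:
  "Poly_Mapping.keys (homogeneous_component d p) = {m \<in> Poly_Mapping.keys p. mon_degree m = d}"
  by (auto simp: in_keys_iff lookup_homogeneous_component split: if_splits)

text \<open>Multiplying \<open>p\<close> by a monomial \<open>m\<close> moves the test monomial from
  \<open>n\<close> to \<open>m + n\<close>, and the set of all test monomials is closed under this
  shift.\<close>

lemma ideal_apolar_ideal: "ideal (apolar_ideal r \<phi>) (mpoly_ring r)"
proof -
  interpret cring "mpoly_ring r :: 'a mpoly ring" by (rule cring_mpoly_ring)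
  let ?I = "apolar_ideal r \<phi>"
  have mult: "q * p \<in> ?I" if p: "p \<in> ?I" and q: "q \<in> carrier (mpoly_ring r)" for p q
  proof -
    have "apolar_pairing \<phi> (q * p) n = 0" if n: "n \<in> vmonomials r" for n
    proof -
      have "q * p = (\<Sum>m\<in>Poly_Mapping.keys q. Poly_Mapping.single m (Poly_Mapping.lookup q m) * p)"
        by (subst (1) poly_mapping_sum_single[of "Poly_Mapping.keys q" q]) (auto simp: sum_distrib_right)
      then have "apolar_pairing \<phi> (q * p) n =
          (\<Sum>m\<in>Poly_Mapping.keys q. Poly_Mapping.lookup q m * apolar_pairing \<phi> p (m + n))"
        by (simp add: apolar_pairing_sum apolar_pairing_mult_single)
      also have "\<dots> = 0"
      proof (rule sum.neutral, rule ballI)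
        fix m assume "m \<in> Poly_Mapping.keys q"
        then have "m + n \<in> vmonomials r" using q n by (auto simp: mpoly_carrier keys_monomial_add)
        then show "Poly_Mapping.lookup q m * apolar_pairing \<phi> p (m + n) = 0"
          using p by (simp add: apolar_ideal_def)
      qed
      finally show ?thesis .
    qed
    moreover have "q * p \<in> carrier (mpoly_ring r)"
      using p q by (intro mpoly_carrier_mult) (auto simp: apolar_ideal_def)
    ultimately show ?thesis by (simp add: apolar_ideal_def)
  qed
  show ?thesis
  proof (rule idealI[OF ring_axioms])
    show "subgroup ?I (add_monoid (mpoly_ring r))"
    proof (rule add.subgroupI)
      show "?I \<noteq> {}" using zero_closed by (auto simp: apolar_ideal_def intro!: exI[of _ 0])
    next
      fix p q assume "p \<in> ?I" "q \<in> ?I"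
      then show "p \<oplus>\<^bsub>mpoly_ring r\<^esub> q \<in> ?I"
        by (auto simp: apolar_ideal_def apolar_pairing_add intro!: mpoly_carrier_add)
    next
      fix p assume "p \<in> ?I"
      then show "\<ominus>\<^bsub>mpoly_ring r\<^esub> p \<in> ?I"
        by (auto simp: apolar_ideal_def apolar_pairing_uminus mpoly_a_inv intro!: mpoly_carrier_uminus)
    qed (auto simp: apolar_ideal_def)
  qed (use mult in \<open>simp_all add: mult.commute\<close>)
qed

text \<open>The ranks of the catalecticant matrices enter as data: \<open>B d\<close> becomes a
  monomial basis of the piece of degree \<open>d\<close>. \<open>basis_1\<close> keeps linear forms
  out of the ideal, and \<open>basis_E\<close> makes the socle one-dimensional.\<close>

locale apolar_form =
  fixes r E :: nat and \<phi> :: "(nat \<Rightarrow>\<^sub>0 nat) \<Rightarrow> 'k::field" and B :: "nat \<Rightarrow> (nat \<Rightarrow>\<^sub>0 nat) set"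
  assumes phi_degree: "\<phi> m \<noteq> 0 \<Longrightarrow> mon_degree m = E"
    and basis: "d \<le> E \<Longrightarrow> row_basis (\<lambda>m n. \<phi> (m + n)) (monomials r d) (monomials r (E - d)) (B d)"
    and basis_1: "B 1 = monomials r 1" and basis_E: "card (B E) = 1" and E_pos: "1 \<le> E"
begin

abbreviation "I \<equiv> apolar_ideal r \<phi>"

lemma apolar_pairing_degree:
  assumes "mon_degree n + d = E"
  shows "apolar_pairing \<phi> p n = apolar_pairing \<phi> (homogeneous_component d p) n"
proof -
  have "Poly_Mapping.lookup p m * \<phi> (m + n) = Poly_Mapping.lookup (homogeneous_component d p) m * \<phi> (m + n)" for m
    using phi_degree[of "m + n"] assms
    by (cases "\<phi> (m + n) = 0") (auto simp: lookup_homogeneous_component mon_degree_add)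
  moreover have "apolar_pairing \<phi> (homogeneous_component d p) n =
      (\<Sum>m\<in>Poly_Mapping.keys p. Poly_Mapping.lookup (homogeneous_component d p) m * \<phi> (m + n))"
    by (rule apolar_pairing_superset) (auto simp: keys_homogeneous_component)
  ultimately show ?thesis by (simp only: apolar_pairing_def[of \<phi> p])
qed

lemma apolar_pairing_form:
  assumes "p \<in> forms r d" "mon_degree n + d \<noteq> E"
  shows "apolar_pairing \<phi> p n = 0"
  unfolding apolar_pairing_def
proof (rule sum.neutral, rule ballI)
  fix m assume "m \<in> Poly_Mapping.keys p"
  then have "mon_degree (m + n) \<noteq> E" using assms by (auto simp: forms_iff monomials_def mon_degree_add)
  then show "Poly_Mapping.lookup p m * \<phi> (m + n) = 0" using phi_degree by force
qed

lemma homogeneous_component_form: "p \<in> carrier (mpoly_ring r) \<Longrightarrow> homogeneous_component d p \<in> forms r d"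
  by (auto simp: forms_iff keys_homogeneous_component mpoly_carrier monomials_def)

lemma form_carrier: "p \<in> forms r d \<Longrightarrow> p \<in> carrier (mpoly_ring r)"
  by (simp add: forms_def)

lemma homogeneous: "homogeneous_ideal r I"
  unfolding homogeneous_ideal_def
proof (intro conjI ballI allI ideal_apolar_ideal)
  fix p d assume p: "p \<in> I"
  then have c: "p \<in> carrier (mpoly_ring r)" by (simp add: apolar_ideal_def)
  have "apolar_pairing \<phi> (homogeneous_component d p) n = 0" if "n \<in> vmonomials r" for n
  proof (cases "mon_degree n + d = E")
    case True
    then show ?thesis using apolar_pairing_degree[OF True, of p] p that by (simp add: apolar_ideal_def)
  qed (rule apolar_pairing_form[OF homogeneous_component_form[OF c]])
  then show "homogeneous_component d p \<in> I"
    using form_carrier[OF homogeneous_component_form[OF c]] by (simp add: apolar_ideal_def)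
qed

text \<open>Test monomials of any other degree give products of degree different from
  \<open>E\<close>, where \<open>\<phi>\<close> vanishes. Membership in a fixed degree is thus a
  question about one finite matrix.\<close>

lemma form_in_I_iff:
  assumes "p \<in> forms r d" "d \<le> E"
  shows "p \<in> I \<longleftrightarrow> (\<forall>n\<in>monomials r (E - d). apolar_pairing \<phi> p n = 0)"
  using apolar_pairing_form[OF assms(1)] form_carrier[OF assms(1)] assms(2)
  by (auto simp: apolar_ideal_def monomials_def) (metis le_add_diff_inverse2 diff_add_inverse2)

lemma large_form_in_I: "p \<in> forms r d \<Longrightarrow> E < d \<Longrightarrow> p \<in> I"
  using apolar_pairing_form[of p d] form_carrier[of p d] by (auto simp: apolar_ideal_def)

lemma basis_subset: "d \<le> E \<Longrightarrow> B d \<subseteq> monomials r d" "d \<le> E \<Longrightarrow> finite (B d)"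
  using basis[of d] by (auto simp: row_basis_def)

lemma basis_indep:
  assumes "d \<le> E" "p \<in> I" "Poly_Mapping.keys p \<subseteq> B d"
  shows "p = 0"
proof (rule poly_mapping_eqI)
  fix m
  have "Poly_Mapping.lookup p m = 0" if "m \<in> B d"
  proof (rule row_basis_indep[OF basis[OF assms(1)] _ that])
    fix n assume "n \<in> monomials r (E - d)"
    then show "(\<Sum>m\<in>B d. Poly_Mapping.lookup p m * \<phi> (m + n)) = 0"
      using assms(2) apolar_pairing_superset[OF basis_subset(2)[OF assms(1)] assms(3), of \<phi> n]
      by (simp add: apolar_ideal_def monomials_def)
  qed
  then show "Poly_Mapping.lookup p m = Poly_Mapping.lookup 0 m"
    using assms(3) by (cases "m \<in> B d") (auto simp: in_keys_iff)
qed

text \<open>A row of the catalecticant matrix is a combination of the basis rows, and a relation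
  between rows is precisely a form in the ideal.\<close>

lemma monomial_reduce:
  assumes "m \<in> monomials r d" "d \<le> E"
  shows "\<exists>q. Poly_Mapping.keys q \<subseteq> B d \<and> Poly_Mapping.single m 1 - q \<in> I"
proof -
  obtain c where c: "\<And>n. n \<in> monomials r (E - d) \<Longrightarrow> \<phi> (m + n) = (\<Sum>b\<in>B d. c b * \<phi> (b + n))"
    using basis[OF assms(2)] assms(1) unfolding row_basis_def by blast
  let ?q = "\<Sum>b\<in>B d. Poly_Mapping.single b (c b)"
  have q: "Poly_Mapping.keys ?q \<subseteq> B d"
    using keys_sum[of "\<lambda>b. Poly_Mapping.single b (c b)" "B d"] by (auto split: if_splits)
  have "Poly_Mapping.single m 1 - ?q \<in> forms r d"
    using keys_diff[of "Poly_Mapping.single m 1" ?q] q basis_subset(1)[OF assms(2)] assms(1)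
    by (auto simp: forms_iff split: if_splits)
  then have "Poly_Mapping.single m 1 - ?q \<in> I"
    using c assms(2) by (simp add: form_in_I_iff apolar_pairing_diff apolar_pairing_sum apolar_pairing_single)
  with q show ?thesis by blast
qed

lemma form_reduce:
  assumes "p \<in> forms r d" "d \<le> E"
  shows "\<exists>q. Poly_Mapping.keys q \<subseteq> B d \<and> p - q \<in> I"
proof -
  interpret J: ideal I "mpoly_ring r" by (rule ideal_apolar_ideal)
  obtain q where q: "\<And>m. m \<in> monomials r d \<Longrightarrow> Poly_Mapping.keys (q m) \<subseteq> B d"
      "\<And>m. m \<in> monomials r d \<Longrightarrow> Poly_Mapping.single m 1 - q m \<in> I"
    using monomial_reduce[OF _ assms(2)] by metis
  let ?c = "\<lambda>m. mpoly_const (Poly_Mapping.lookup p m)"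
  let ?q = "\<Sum>m\<in>Poly_Mapping.keys p. ?c m * q m"
  have K: "Poly_Mapping.keys p \<subseteq> monomials r d" using assms(1) by (simp add: forms_iff)
  have keys_c: "Poly_Mapping.keys (mpoly_const a * x) \<subseteq> Poly_Mapping.keys x" for a and x :: "'k mpoly"
    using keys_mult[of "mpoly_const a" x] by (auto simp: mpoly_const_def split: if_splits)
  have "Poly_Mapping.keys ?q \<subseteq> (\<Union>m\<in>Poly_Mapping.keys p. Poly_Mapping.keys (?c m * q m))" by (rule keys_sum)
  also have "\<dots> \<subseteq> B d" using keys_c q(1) K by blast
  finally have "Poly_Mapping.keys ?q \<subseteq> B d" .
  moreover have "p - ?q = (\<Sum>m\<in>Poly_Mapping.keys p. ?c m * (Poly_Mapping.single m 1 - q m))"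
    by (subst (1) poly_mapping_sum_single[of "Poly_Mapping.keys p" p])
       (auto simp: sum_subtractf right_diff_distrib mpoly_const_mult_single)
  moreover have "(\<Sum>m\<in>M. ?c m * (Poly_Mapping.single m 1 - q m)) \<in> I" if "M \<subseteq> monomials r d" for M
    using that
  proof (induction M rule: infinite_finite_induct)
    case (insert m M)
    then have "?c m * (Poly_Mapping.single m 1 - q m) \<in> I"
      using J.I_l_closed[OF q(2) mpoly_const_carrier[of _ r]] by simp
    moreover have "(\<Sum>m\<in>M. ?c m * (Poly_Mapping.single m 1 - q m)) \<in> I" using insert by simp
    ultimately show ?case
      using additive_subgroup.a_closed[OF ideal.axioms(1)[OF ideal_apolar_ideal]] insert.hyps by simp
  qed (simp_all add: apolar_ideal_def mpoly_carrier)
  ultimately show ?thesis using K by (intro exI[of _ ?q]) auto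
qed

text \<open>Otherwise the single monomial of \<open>B E\<close> would lie in the ideal, against
  \<open>basis_indep\<close>.\<close>

lemma one_notin: "1 \<notin> I"
proof
  assume "1 \<in> I"
  obtain b where b: "B E = {b}" using basis_E card_1_singletonE by blast
  then have bE: "b \<in> monomials r E" using basis_subset(1)[of E] by auto
  then have "Poly_Mapping.single b 1 \<in> carrier (mpoly_ring r)"
    by (auto simp: mpoly_carrier monomials_def)
  from ideal.I_r_closed[OF ideal_apolar_ideal \<open>1 \<in> I\<close> this]
  have "Poly_Mapping.single b (1 :: 'k) \<in> I" by simp
  from basis_indep[OF _ this, of E] b show False 
    by (metis keys_single keys_zero insert_not_empty order_refl order_refl zero_neq_one)
qed

sublocale proper_mpoly_ideal r I
proof (rule proper_mpoly_ideal.intro)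
  show "I \<noteq> carrier (mpoly_ring r)" using one_notin mpoly_const_carrier[of 1 r] by (auto simp: mpoly_const_simps)
qed (rule ideal_apolar_ideal)

lemma dimension_graded_piece:
  assumes "d \<le> E"
  shows "Q.dimension (card (B d)) (scalars r I) (graded_piece r I d)"
proof -
  have B: "finite (B d)" "B d \<subseteq> monomials r d" using basis_subset assms by blast+
  have "graded_piece r I d = residue_class r I ` {p. Poly_Mapping.keys p \<subseteq> B d}"
    unfolding graded_piece_def
  proof (intro equalityI subsetI)
    fix u assume "u \<in> residue_class r I ` forms r d"
    then obtain p where p: "p \<in> forms r d" "u = residue_class r I p" by blast
    then obtain q where q: "Poly_Mapping.keys q \<subseteq> B d" "p - q \<in> I" using form_reduce assms by blast
    then have "q \<in> carrier (mpoly_ring r)" using B by (auto simp: mpoly_carrier monomials_def)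
    then have "u = residue_class r I q" using p q(2) residue_eq_iff[OF form_carrier] by simp
    with q(1) show "u \<in> residue_class r I ` {p. Poly_Mapping.keys p \<subseteq> B d}" by blast
  qed (use B in \<open>auto simp: forms_iff\<close>)
  moreover have "Q.dimension (card (B d)) (scalars r I) (residue_class r I ` {p. Poly_Mapping.keys p \<subseteq> B d})"
    by (rule dimension_residue) (use B basis_indep[OF assms] in \<open>auto simp: monomials_def\<close>)
  ultimately show ?thesis by simp
qed

lemma hilb_eq: "d \<le> E \<Longrightarrow> hilb r I d = card (B d)"
  by (rule hilb_eqI[OF dimension_graded_piece])

lemma hilb_large:
  assumes "E < d"
  shows "hilb r I d = 0"
proof (rule hilb_eqI)
  have "residue_class r I p = \<zero>\<^bsub>quot_alg r I\<^esub>" if "p \<in> forms r d" for p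
    using residue_0_iff[OF form_carrier[OF that]] large_form_in_I[OF that assms] by simp
  moreover have "0 \<in> forms r d" by (simp add: forms_iff)
  ultimately have "graded_piece r I d = {\<zero>\<^bsub>quot_alg r I\<^esub>}"
    unfolding graded_piece_def by force
  then show "Q.dimension 0 (scalars r I) (graded_piece r I d)" by simp
qed

lemma socle_degree_eq: "socle_degree r I = E"
  unfolding socle_degree_def
proof (rule Max_eqI)
  have "{d. 0 < hilb r I d} \<subseteq> {..E}"
    using hilb_large by (auto simp: not_less[symmetric])
  then show "finite {d. 0 < hilb r I d}" by (rule finite_subset) simp
qed (use hilb_large hilb_eq[of E] basis_E in \<open>auto simp: not_less[symmetric]\<close>)

lemma h_vector_eq: "h_vector r I = map (\<lambda>d. card (B d)) [0..<E + 1]"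
  unfolding h_vector_def socle_degree_eq by (rule map_cong) (auto simp: hilb_eq)

lemma finite_dimension_quot: "Q.finite_dimension (scalars r I) (carrier (quot_alg r I))"
proof -
  let ?B = "\<Union>d\<le>E. B d"
  have B: "finite ?B" "?B \<subseteq> vmonomials r" using basis_subset by (auto simp: monomials_def)
  obtain ms where ms: "set ms = ?B" using finite_list[OF B(1)] by blast
  let ?Us = "map (\<lambda>m. residue_class r I (Poly_Mapping.single m 1)) ms"
  have "carrier (quot_alg r I) \<subseteq> Q.Span (scalars r I) ?Us"
  proof
    fix u assume "u \<in> carrier (quot_alg r I)"
    then obtain p where p: "p \<in> carrier (mpoly_ring r)" "u = residue_class r I p"
      unfolding quot_carrier by blast
    have form: "homogeneous_component d p \<in> forms r d" for d by (rule homogeneous_component_form[OF p(1)])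
    obtain q where q: "\<And>d. d \<le> E \<Longrightarrow> Poly_Mapping.keys (q d) \<subseteq> B d"
      "\<And>d. d \<le> E \<Longrightarrow> homogeneous_component d p - q d \<in> I"
      using form_reduce[OF form] by metis
    let ?c = "\<lambda>d. homogeneous_component d p" and ?q = "\<Sum>d\<le>E. q d"
    \<comment> \<open>A bound for the degrees of all monomials of \<open>p\<close> that is also at
      least \<open>E\<close>, so that the sum of the components can be split at
      \<open>E\<close>.\<close>
    let ?N = "E + (\<Sum>m\<in>Poly_Mapping.keys p. mon_degree m)"
    have N: "mon_degree m \<le> ?N" if "Poly_Mapping.lookup p m \<noteq> 0" for m
      using that by (intro trans_le_add2 member_le_sum) (auto simp: in_keys_iff)
    have p_sum: "p = (\<Sum>d\<le>?N. ?c d)"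
      by (rule poly_mapping_eqI) (use N in \<open>auto simp: lookup_sum lookup_homogeneous_component\<close>)
    have keys_q: "Poly_Mapping.keys ?q \<subseteq> ?B"
      using keys_sum[of q "{..E}"] q(1) by fastforce
    have "p - ?q = (\<Sum>d\<le>E. ?c d - q d) + (\<Sum>d\<in>{..?N} - {..E}. ?c d)"
      by (subst p_sum, subst sum.subset_diff[of "{..E}"]) (auto simp: sum_subtractf)
    also have "\<dots> \<in> I"
      by (intro I_add I_sum) (use q(2) large_form_in_I[OF form] in auto)
    finally have "p - ?q \<in> I" .
    moreover have "?q \<in> carrier (mpoly_ring r)" using keys_q B(2) by (simp add: mpoly_carrier)
    ultimately have "u = residue_class r I ?q" using p residue_eq_iff by blast
    then show "u \<in> Q.Span (scalars r I) ?Us"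
      using Span_residue[of ms] ms B(2) keys_q by auto
  qed
  moreover have Us: "set ?Us \<subseteq> carrier (quot_alg r I)"
    using ms B(2) by (auto intro!: h.hom_closed simp: mpoly_carrier)
  moreover have "Q.Span (scalars r I) ?Us \<subseteq> carrier (quot_alg r I)"
    using Q.Span_in_carrier[OF _ Us] subfieldE(3)[OF subfield_scalars] by blast
  ultimately have "carrier (quot_alg r I) = Q.Span (scalars r I) ?Us" by blast
  then show ?thesis using Q.Span_finite_dimension[OF subfield_scalars Us] by simp
qed

lemma standard_graded: "standard_graded_artinian r I"
  unfolding standard_graded_artinian_def
proof (intro conjI homogeneous proper_I finite_dimension_quot)
  have "p = 0" if "p \<in> I" "p \<in> forms r 1" for p
    using basis_indep[OF E_pos that(1)] that(2) basis_1 by (simp add: forms_iff)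
  moreover have "0 \<in> I \<inter> forms r 1" using I_zero by (simp add: forms_iff)
  ultimately show "I \<inter> forms r 1 = {0}" by blast
qed

lemma var_carrier: "i < r \<Longrightarrow> mpoly_var i \<in> carrier (mpoly_ring r)"
  by (simp add: mpoly_var_def mpoly_carrier)

text \<open>An element killed by all variables pairs to zero with every monomial other than \<open>1\<close>, so
  only its component of degree \<open>E\<close> survives modulo the ideal.\<close>

lemma socle_eq: "socle r I = graded_piece r I E"
proof (intro equalityI subsetI)
  fix a assume a: "a \<in> socle r I"
  then obtain p where p: "p \<in> carrier (mpoly_ring r)" "a = residue_class r I p"
    unfolding socle_def quot_carrier by blast
  have var: "mpoly_var i * p \<in> I" if i: "i < r" for i
  proof -
    have "(\<lambda>i. residue_class r I (mpoly_var i)) ` {..<r} \<subseteq> max_ideal r I"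
      unfolding max_ideal_def by (intro Q.genideal_self) (auto intro!: h.hom_closed var_carrier)
    then have "a \<otimes>\<^bsub>quot_alg r I\<^esub> residue_class r I (mpoly_var i) = \<zero>\<^bsub>quot_alg r I\<^esub>"
      using a i unfolding socle_def by blast
    then have "residue_class r I (p * mpoly_var i) = \<zero>\<^bsub>quot_alg r I\<^esub>"
      using h.hom_mult[OF p(1) var_carrier[OF i]] p(2) by simp
    then show ?thesis
      using residue_0_iff[OF mpoly_carrier_mult[OF p(1) var_carrier[OF i]]] by (simp add: mult.commute)
  qed
  let ?c = "homogeneous_component E p"
  have form: "?c \<in> forms r E" by (rule homogeneous_component_form[OF p(1)])
  have "apolar_pairing \<phi> (p - ?c) n = 0" if n: "n \<in> vmonomials r" for n
  proof (cases "n = 0")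
    case True
    then show ?thesis using apolar_pairing_degree[of n E p] by (simp add: apolar_pairing_diff)
  next
    case False
    then obtain i where i: "i \<in> Poly_Mapping.keys n" by (metis all_not_in_conv keys_eq_empty)
    let ?e = "Poly_Mapping.single i (1::nat)"
    have ni: "?e + (n - ?e) = n"
      by (rule poly_mapping_eqI) (use i in \<open>auto simp: lookup_add lookup_minus lookup_single when_def in_keys_iff\<close>)
    have "Poly_Mapping.keys (n - ?e) \<subseteq> Poly_Mapping.keys n"
      by (auto simp: in_keys_iff lookup_minus)
    then have "n - ?e \<in> vmonomials r" "i < r" using n i by auto
    then have "apolar_pairing \<phi> (mpoly_var i * p) (n - ?e) = 0"
      using var[of i] unfolding apolar_ideal_def by blast
    then have "apolar_pairing \<phi> p n = 0"
      by (simp add: mpoly_var_def apolar_pairing_mult_single ni del: One_nat_def)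
    moreover have "apolar_pairing \<phi> ?c n = 0"
      by (rule apolar_pairing_form[OF form]) (use False in simp)
    ultimately show ?thesis by (simp add: apolar_pairing_diff)
  qed
  then have "p - ?c \<in> I"
    using mpoly_carrier_diff[OF p(1) form_carrier[OF form]] unfolding apolar_ideal_def by blast
  then have "a = residue_class r I ?c"
    using p residue_eq_iff[OF p(1) form_carrier[OF form]] by simp
  then show "a \<in> graded_piece r I E" unfolding graded_piece_def using form by blast
next
  fix a assume "a \<in> graded_piece r I E"
  then obtain p where p: "p \<in> forms r E" "a = residue_class r I p"
    unfolding graded_piece_def by blast
  \<comment> \<open>The annihilator of \<open>a\<close> is an ideal, so it contains the maximal
    ideal as soon as it contains the variables; these raise the degree beyond
    \<open>E\<close>.\<close>
  let ?J = "{b \<in> carrier (quot_alg r I). a \<otimes>\<^bsub>quot_alg r I\<^esub> b = \<zero>\<^bsub>quot_alg r I\<^esub>}"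
  have a: "a \<in> carrier (quot_alg r I)" using p form_carrier h.hom_closed by blast
  have "ideal ?J (quot_alg r I)"
  proof (rule idealI[OF Q.ring_axioms])
    show "subgroup ?J (add_monoid (quot_alg r I))"
      by (rule Q.add.subgroupI) (use a in \<open>auto simp: Q.r_distr Q.r_minus intro!: exI[of _ "\<zero>\<^bsub>quot_alg r I\<^esub>"]\<close>)
  next
    fix b x assume bx: "b \<in> ?J" "x \<in> carrier (quot_alg r I)"
    then have "a \<otimes>\<^bsub>quot_alg r I\<^esub> (b \<otimes>\<^bsub>quot_alg r I\<^esub> x) = \<zero>\<^bsub>quot_alg r I\<^esub>"
      using a by (simp add: Q.m_assoc[symmetric])
    with bx show "x \<otimes>\<^bsub>quot_alg r I\<^esub> b \<in> ?J" "b \<otimes>\<^bsub>quot_alg r I\<^esub> x \<in> ?J"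
      by (auto simp: Q.m_comm)
  qed
  moreover have "(\<lambda>i. residue_class r I (mpoly_var i)) ` {..<r} \<subseteq> ?J"
  proof clarify
    fix i assume i: "i < r"
    have "p * mpoly_var i \<in> forms r (Suc E)"
      unfolding forms_iff
    proof
      fix m assume "m \<in> Poly_Mapping.keys (p * mpoly_var i)"
      then obtain b where "b \<in> Poly_Mapping.keys p" "m = b + Poly_Mapping.single i 1"
        using keys_mult[of p "mpoly_var i"] by (auto simp: mpoly_var_def)
      then show "m \<in> monomials r (Suc E)"
        using p(1) i by (auto simp: forms_iff monomials_def mon_degree_add keys_monomial_add)
    qed
    then have "p * mpoly_var i \<in> I" by (rule large_form_in_I) simp
    then show "residue_class r I (mpoly_var i) \<in> carrier (quot_alg r I) \<and>
        a \<otimes>\<^bsub>quot_alg r I\<^esub> residue_class r I (mpoly_var i) = \<zero>\<^bsub>quot_alg r I\<^esub>"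
      using h.hom_mult[OF form_carrier[OF p(1)] var_carrier[OF i]] p(2) h.hom_closed[OF var_carrier[OF i]]
        residue_0_iff[OF I_carrier] by simp
  qed
  ultimately have "max_ideal r I \<subseteq> ?J" unfolding max_ideal_def by (rule Q.genideal_minimal)
  with a show "a \<in> socle r I" unfolding socle_def by blast
qed

lemma gorenstein: "gorenstein_algebra r I"
  unfolding gorenstein_algebra_def level_algebra_def socle_degree_eq
  using standard_graded socle_eq dimension_graded_piece[of E] basis_E by simp

end

section \<open>The dual form\<close>

type_synonym triple = "nat \<times> nat \<times> nat"

text \<open>The exponents of \<open>F\<^sub>0\<close> and \<open>F\<^sub>1\<close>, the outcome of a computer search for supports satisfying
  \<open>solvable_x_part\<close> and \<open>solvable_y_part\<close>.\<close>

definition dual_supp :: "nat \<Rightarrow> triple list" where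
  "dual_supp i = (if i = 0 then [(5,19,5), (11,6,12)]
     else if i = 1 then [(0,0,29), (7,9,13), (9,11,9), (10,5,14), (17,7,5)] else [])"

fun triple_add :: "triple \<Rightarrow> triple \<Rightarrow> triple" where
  "triple_add (a, b, c) (a', b', c') = (a + a', b + b', c + c')"

fun triple_degree :: "triple \<Rightarrow> nat" where
  "triple_degree (a, b, c) = a + b + c"

fun triple_quotients :: "triple \<Rightarrow> triple list \<Rightarrow> triple list" where
  "triple_quotients (a, b, c) ts = [(a' - a, b' - b, c' - c). (a', b', c') \<leftarrow> ts, a \<le> a' \<and> b \<le> b' \<and> c \<le> c']"

text \<open>Sparse description of the matrix \<open>cat_entry\<close>: a column
  \<open>(i, u)\<close> stands for the monomial u in the i-th component, and it is nonzero exactly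
  in the rows that complete u to a monomial of F_i.\<close>

definition rows_of :: "nat \<times> triple \<Rightarrow> triple list" where
  "rows_of y = triple_quotients (snd y) (dual_supp (fst y))"

definition cols_of :: "triple \<Rightarrow> (nat \<times> triple) list" where
  "cols_of t = [(i, u). i \<leftarrow> [0, 1], u \<leftarrow> triple_quotients t (dual_supp i)]"

definition triples :: "nat \<Rightarrow> triple list" where
  "triples n = [(a, b, n - a - b). a \<leftarrow> [0..<n+1], b \<leftarrow> [0..<n+1-a]]"

text \<open>The monomials of degree \<open>n\<close> outside the ideal generated by \<open>x\<^sub>2\<^sup>1\<^sup>5 x\<^sub>0\<close> and \<open>x\<^sub>2\<^sup>1\<^sup>5 x\<^sub>1\<close>.\<close>

definition x_part :: "nat \<Rightarrow> triple list" where
  "x_part n = filter (\<lambda>(a, b, c). \<not> (15 \<le> c \<and> c < n)) (triples n)"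

definition y_part :: "nat \<Rightarrow> (nat \<times> triple) list" where
  "y_part n = [(i, u). i \<leftarrow> [0, 1], u \<leftarrow> triples n]"

text \<open>The 166 coefficients of a form of degree 17 without terms in J are the unknowns;
  contracting F_0 and F_1 to 0 gives the equations, indexed by columns of degree 12. Five rounds
  suffice.\<close>

lemma solvable_x_part: "list_all (solvable rows_of cols_of 5) (x_part 17)"
  by code_simp

text \<open>The transposed system: the unknowns are the 156 coefficients of a pair of forms of
  degree 11, the equations are indexed by the monomials of degree 18.\<close>

lemma solvable_y_part: "list_all (solvable cols_of rows_of 5) (y_part 11)"
  by code_simp

text \<open>The catalecticant matrix of the pair (F_0, F_1), all degrees at once.\<close>

definition cat_entry :: "triple \<Rightarrow> nat \<times> triple \<Rightarrow> 'k::field" where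
  "cat_entry t y = of_bool (triple_add t (snd y) \<in> set (dual_supp (fst y)))"

definition x_exp :: "nat \<Rightarrow> triple set" where
  "x_exp d = {t. triple_degree t = d}"

definition y_exp :: "nat \<Rightarrow> (nat \<times> triple) set" where
  "y_exp d = {y. fst y < 2 \<and> triple_degree (snd y) = d}"

lemma set_triple_quotients: "u \<in> set (triple_quotients t ts) \<longleftrightarrow> triple_add t u \<in> set ts"
proof -
  obtain a b c a' b' c' where tu: "t = (a, b, c)" "u = (a', b', c')" by (metis prod_cases3)
  then have "u \<in> set (triple_quotients t ts) \<longleftrightarrow>
      (\<exists>x y z. (x, y, z) \<in> set ts \<and> a \<le> x \<and> b \<le> y \<and> c \<le> z \<and> a' = x - a \<and> b' = y - b \<and> c' = z - c)"
    by auto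
  also have "\<dots> \<longleftrightarrow> (a + a', b + b', c + c') \<in> set ts"
    by (metis le_add1 le_add_diff_inverse diff_add_inverse)
  finally show ?thesis by (simp add: tu)
qed

lemma triple_add_commute: "triple_add t u = triple_add u t"
  by (cases t; cases u) (auto simp: add.commute)

lemma triple_add_assoc: "triple_add (triple_add t u) v = triple_add t (triple_add u v)"
  by (cases t; cases u; cases v) (auto simp: add.assoc)

lemma triple_degree_add: "triple_degree (triple_add t u) = triple_degree t + triple_degree u"
  by (cases t; cases u) auto

lemma dual_supp_degree: "t \<in> set (dual_supp i) \<Longrightarrow> triple_degree t = 29"
  by (auto simp: dual_supp_def split: if_splits)

text \<open>The default \<open>[]\<close> in \<open>dual_supp\<close> makes larger indices harmless,
  so \<open>cat_entry\<close> and \<open>dual_form\<close> can be stated without a bound on the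
  index.\<close>

lemma dual_supp_index: "t \<in> set (dual_supp i) \<Longrightarrow> i < 2"
  by (auto simp: dual_supp_def split: if_splits)

lemma cat_entry_rows: "cat_entry t y \<noteq> 0 \<longleftrightarrow> t \<in> set (rows_of y)"
  by (simp add: cat_entry_def rows_of_def set_triple_quotients triple_add_commute)

lemma cat_entry_cols: "cat_entry t y \<noteq> 0 \<longleftrightarrow> y \<in> set (cols_of t)"
proof -
  have "y \<in> set (cols_of t) \<longleftrightarrow> fst y < 2 \<and> snd y \<in> set (triple_quotients t (dual_supp (fst y)))"
    by (cases y) (auto simp: cols_of_def less_2_cases_iff)
  then show ?thesis
    using dual_supp_index[of "triple_add t (snd y)" "fst y"] by (auto simp: cat_entry_def set_triple_quotients)
qed

lemma set_triples: "set (triples n) = x_exp n"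
proof (rule Set.set_eqI)
  fix t :: triple
  obtain a b c where t: "t = (a, b, c)" by (metis prod_cases3)
  have "t \<in> set (triples n) \<longleftrightarrow> (\<exists>a'<n + 1. \<exists>b'<n + 1 - a'. t = (a', b', n - a' - b'))"
    by (auto simp: triples_def image_iff Bex_def simp del: upt_Suc)
  also have "\<dots> \<longleftrightarrow> a + b + c = n" unfolding t by auto
  finally show "t \<in> set (triples n) \<longleftrightarrow> t \<in> x_exp n" by (simp add: t x_exp_def)
qed

lemma distinct_concat_map:
  assumes "distinct xs" "\<And>x. x \<in> set xs \<Longrightarrow> distinct (f x)"
    and "\<And>x y. x \<in> set xs \<Longrightarrow> y \<in> set xs \<Longrightarrow> x \<noteq> y \<Longrightarrow> set (f x) \<inter> set (f y) = {}"
  shows "distinct (concat (map f xs))"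
  using assms by (induction xs) fastforce+

lemma distinct_triples: "distinct (triples n)"
  unfolding triples_def
  by (intro distinct_concat_map) (auto simp: distinct_map inj_on_def)

lemma distinct_x_part: "distinct (x_part n)"
  by (simp add: x_part_def distinct_triples)

lemma distinct_y_part: "distinct (y_part n)"
  unfolding y_part_def
  by (intro distinct_concat_map) (auto simp: distinct_map inj_on_def distinct_triples)

lemma set_x_part: "set (x_part n) = {t \<in> x_exp n. \<not> (15 \<le> snd (snd t) \<and> snd (snd t) < n)}"
  by (auto simp: x_part_def set_triples)

lemma set_y_part: "set (y_part n) = y_exp n"
  by (auto simp: y_part_def set_triples y_exp_def x_exp_def less_2_cases_iff)


lemma cat_entry_degree:
  assumes "cat_entry t y \<noteq> 0"
  shows "fst y < 2" "triple_degree t + triple_degree (snd y) = 29"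
  using assms dual_supp_degree[of "triple_add t (snd y)" "fst y"]
    dual_supp_index[of "triple_add t (snd y)" "fst y"] triple_degree_add[of t "snd y"]
  by (auto simp: cat_entry_def split: if_splits)

lemma cat_entry_shift: "cat_entry (triple_add t w) y = cat_entry t (fst y, triple_add w (snd y))"
  by (simp add: cat_entry_def triple_add_assoc)

text \<open>The only monomial of F_0 and F_1 with exponent of x_2 at least 15 is x_2^29, which
  contains neither x_0 nor x_1. Hence J annihilates both forms.\<close>

lemma cat_entry_x_part:
  assumes "triple_degree t = n" "t \<notin> set (x_part n)" "n \<le> 29"
  shows "cat_entry t y = 0"
proof (rule ccontr)
  assume nz: "cat_entry t y \<noteq> 0"
  obtain a b c a' b' c' where t: "t = (a, b, c)" "snd y = (a', b', c')" by (metis prod_cases3)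
  with nz have "(a + a', b + b', c + c') \<in> set (dual_supp (fst y))" by (simp add: cat_entry_def split: if_splits)
  moreover have "15 \<le> c" "c < a + b + c" using assms t by (auto simp: set_x_part x_exp_def)
  ultimately show False by (auto simp: dual_supp_def split: if_splits)
qed

text \<open>Entries depend only on the product of the two monomials, so a triangular system in degree
  \<open>17\<close> restricts to all lower degrees; multiplication by a power of the first variable keeps
  \<open>x_part\<close> except for the pure powers of the third variable, which are appended by hand.\<close>

lemma triangular_shift:
  fixes A :: "'a \<Rightarrow> 'b \<Rightarrow> 'k::field"
  assumes "triangular A ps" "inj f" "f ` S \<subseteq> fst ` set ps"
    and "\<And>x y. A x (g y) = A (f x) y"
  shows "\<exists>qs. triangular A qs \<and> fst ` set qs = S \<and> snd ` set qs \<subseteq> g ` snd ` set ps"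
proof -
  define qs where "qs = map (map_prod (inv_into UNIV f) g) (filter (\<lambda>p. fst p \<in> f ` S) ps)"
  have "triangular A qs" unfolding qs_def
    by (rule triangular_map[OF triangular_filter[OF assms(1)]]) (auto simp: assms(4) inv_f_f[OF assms(2)])
  moreover have "fst ` set qs = S"
  proof (intro equalityI subsetI)
    fix x assume "x \<in> fst ` set qs"
    then show "x \<in> S" by (auto simp: qs_def inv_f_f[OF assms(2)])
  next
    fix x assume x: "x \<in> S"
    then obtain p where p: "p \<in> set ps" "fst p = f x" using assms(3) by (metis imageE image_subset_iff)
    then have "map_prod (inv_into UNIV f) g p \<in> set qs" using x by (auto simp: qs_def)
    moreover have "fst (map_prod (inv_into UNIV f) g p) = x" using p by (simp add: inv_f_f[OF assms(2)])
    ultimately show "x \<in> fst ` set qs" by (metis imageI)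
  qed
  moreover have "snd ` set qs \<subseteq> g ` snd ` set ps"
    unfolding qs_def by (auto intro!: imageI) (metis imageI snd_conv)
  ultimately show ?thesis by blast
qed

text \<open>Below the last pivot there are no rows, so only the new row has to vanish in the earlier
  columns.\<close>

lemma triangular_append_last:
  "triangular A ps \<Longrightarrow> A x y \<noteq> 0 \<Longrightarrow> (\<And>p. p \<in> set ps \<Longrightarrow> A x (snd p) = 0) \<Longrightarrow> triangular A (ps @ [(x, y)])"
proof (induction rule: triangular.induct)
  case (Cons x' y' ps)
  have "A x y' = 0" using Cons.prems(2)[of "(x', y')"] by simp
  moreover have "triangular A (ps @ [(x, y)])" by (rule Cons.IH) (use Cons.prems in simp_all)
  ultimately show ?case using Cons.hyps(1,2) by (simp add: triangular.Cons)
qed (simp add: triangular.Nil triangular.Cons)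

lemma triangular_x_17: "\<exists>ps. triangular (cat_entry :: _ \<Rightarrow> _ \<Rightarrow> 'k::field) ps \<and> fst ` set ps = set (x_part 17)"
  by (rule triangular_of_solvable[OF cat_entry_rows cat_entry_cols solvable_x_part])

lemma triangular_x:
  assumes "n \<le> 17"
  shows "\<exists>ps. triangular (cat_entry :: _ \<Rightarrow> _ \<Rightarrow> 'k::field) ps \<and> fst ` set ps = set (x_part n)"
proof (cases "n = 17")
  case False
  obtain ps where ps: "triangular (cat_entry :: _ \<Rightarrow> _ \<Rightarrow> 'k) ps" "fst ` set ps = set (x_part 17)"
    using triangular_x_17 by blast
  let ?w = "(17 - n, 0, 0)"
  \<comment> \<open>This leaves out x_2^n for \<open>n\<close> at least 15, as its product with a
    positive power of x_0 falls into J.\<close>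
  let ?S = "{t \<in> x_exp n. snd (snd t) < 15}"
  have "\<exists>qs. triangular (cat_entry :: _ \<Rightarrow> _ \<Rightarrow> 'k) qs \<and> fst ` set qs = ?S \<and>
      snd ` set qs \<subseteq> (\<lambda>y. (fst y, triple_add ?w (snd y))) ` snd ` set ps"
  proof (rule triangular_shift[where A = cat_entry and f = "\<lambda>t. triple_add t ?w", OF ps(1)])
    show "inj (\<lambda>t. triple_add t ?w)" by (rule injI) auto
    show "(\<lambda>t. triple_add t ?w) ` ?S \<subseteq> fst ` set ps"
      using assms by (auto simp: ps(2) set_x_part x_exp_def)
  qed (rule cat_entry_shift[symmetric])
  then obtain qs where qs: "triangular (cat_entry :: _ \<Rightarrow> _ \<Rightarrow> 'k) qs" "fst ` set qs = ?S"
      "snd ` set qs \<subseteq> (\<lambda>y. (fst y, triple_add ?w (snd y))) ` snd ` set ps"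
    by blast
  show ?thesis
  proof (cases "n < 15")
    case True
    then have "?S = set (x_part n)" by (auto simp: set_x_part x_exp_def)
    with qs show ?thesis by blast
  next
    case n: False
    \<comment> \<open>The new pivot is nonzero because of x_2^29 in F_1. The earlier columns are
      divisible by x_0, so their products with x_2^n involve x_0 and have exponent of x_2 at least
      15, and no such monomial occurs.\<close>
    have "triangular (cat_entry :: _ \<Rightarrow> _ \<Rightarrow> 'k) (qs @ [((0, 0, n), (1, (0, 0, 29 - n)))])"
    proof (rule triangular_append_last[OF qs(1)])
      fix p assume "p \<in> set qs"
      then obtain y where "snd p = (fst y, triple_add ?w (snd y))" using qs(3) by blast
      then show "cat_entry (0, 0, n) (snd p) = (0 :: 'k)"
        using False assms n by (cases y) (auto simp: cat_entry_def dual_supp_def)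
    qed (use assms in \<open>simp add: cat_entry_def dual_supp_def\<close>)
    moreover have "fst ` set (qs @ [((0, 0, n), (1, (0, 0, 29 - n)))]) = set (x_part n)"
      using n qs(2) by (auto simp: set_x_part x_exp_def)
    ultimately show ?thesis by blast
  qed
qed (use triangular_x_17 in simp)

lemma triangular_y:
  assumes "n \<le> 11"
  shows "\<exists>ps. triangular (\<lambda>y t. cat_entry t y :: 'k::field) ps \<and> fst ` set ps = set (y_part n)"
proof -
  have "\<exists>ps. triangular (\<lambda>y t. cat_entry t y :: 'k::field) ps \<and> fst ` set ps = set (y_part 11)"
    by (rule triangular_of_solvable[OF cat_entry_cols cat_entry_rows solvable_y_part])
  then obtain ps where ps: "triangular (\<lambda>y t. cat_entry t y :: 'k) ps" "fst ` set ps = set (y_part 11)" by blast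
  \<comment> \<open>Pairs of forms are multiplied by x_0^(11-n). Nothing is excluded from
    \<open>y_part\<close>, so this reaches all lower degrees without an extra pivot.\<close>
  let ?w = "(11 - n, 0, 0)"
  let ?f = "\<lambda>y. (fst y, triple_add ?w (snd y))"
  have "\<exists>qs. triangular (\<lambda>y t. cat_entry t y :: 'k) qs \<and> fst ` set qs = set (y_part n) \<and>
      snd ` set qs \<subseteq> (\<lambda>t. triple_add t ?w) ` snd ` set ps"
  proof (rule triangular_shift[where A = "\<lambda>y t. cat_entry t y" and f = ?f, OF ps(1)])
    show "inj ?f" by (rule injI) auto
    show "?f ` set (y_part n) \<subseteq> fst ` set ps"
      using assms by (auto simp: ps(2) set_y_part y_exp_def triple_degree_add)
  qed (rule cat_entry_shift)
  then show ?thesis by blast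
qed

section \<open>Exponent triples as monomials of the polynomial ring, and the dual form\<close>

fun x_mon :: "triple \<Rightarrow> (nat \<Rightarrow>\<^sub>0 nat)" where
  "x_mon (a, b, c) = Poly_Mapping.single 0 a + Poly_Mapping.single 1 b + Poly_Mapping.single 2 c"

declare x_mon.simps [simp del]

definition y_mon :: "nat \<times> triple \<Rightarrow> (nat \<Rightarrow>\<^sub>0 nat)" where
  "y_mon y = x_mon (snd y) + Poly_Mapping.single (3 + fst y) 1"

text \<open>The variables \<open>x\<^sub>0, x\<^sub>1, x\<^sub>2\<close> have index \<open>0, 1, 2\<close>, the variables \<open>y\<^sub>0, y\<^sub>1\<close> have index \<open>3, 4\<close>,
  and \<open>z\<^sub>k\<close> has index \<open>k \<ge> 5\<close>.\<close>

definition dual_form :: "nat \<Rightarrow> (nat \<Rightarrow>\<^sub>0 nat) \<Rightarrow> 'k::field" where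
  "dual_form r m = of_bool ((\<exists>y. m = y_mon y \<and> snd y \<in> set (dual_supp (fst y))) \<or>
     (\<exists>k\<in>{5..<r}. m = Poly_Mapping.single k 30))"

abbreviation dual_matrix :: "nat \<Rightarrow> (nat \<Rightarrow>\<^sub>0 nat) \<Rightarrow> (nat \<Rightarrow>\<^sub>0 nat) \<Rightarrow> 'k::field" where
  "dual_matrix r m n \<equiv> dual_form r (m + n)"

lemma lookup_x_mon:
  "Poly_Mapping.lookup (x_mon t) j =
     (if j = 0 then fst t else if j = 1 then fst (snd t) else if j = 2 then snd (snd t) else 0)"
  by (cases t) (auto simp: x_mon.simps lookup_add lookup_single when_def)

lemma lookup_y_mon:
  "Poly_Mapping.lookup (y_mon y) j = Poly_Mapping.lookup (x_mon (snd y)) j + of_bool (j = 3 + fst y)"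
  by (auto simp: y_mon_def lookup_add lookup_single when_def)

lemma x_mon_inj: "x_mon t = x_mon u \<longleftrightarrow> t = u"
proof
  assume "x_mon t = x_mon u"
  then have "Poly_Mapping.lookup (x_mon t) j = Poly_Mapping.lookup (x_mon u) j" for j by simp
  from this[of 0] this[of 1] this[of 2] show "t = u" by (auto simp: lookup_x_mon prod_eq_iff)
qed simp

lemma y_mon_inj: "y_mon y = y_mon z \<longleftrightarrow> y = z"
proof
  assume "y_mon y = y_mon z"
  then have e: "Poly_Mapping.lookup (y_mon y) j = Poly_Mapping.lookup (y_mon z) j" for j by simp
  from e[of 0] e[of 1] e[of 2] e[of "3 + fst y"] show "y = z"
    by (auto simp: lookup_y_mon lookup_x_mon prod_eq_iff of_bool_def split: if_splits)
qed simp

lemma less_3_cases: "j < 3 \<Longrightarrow> j = 0 \<or> j = 1 \<or> j = (2::nat)"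
  by linarith

lemma x_mon_lookup:
  assumes "\<And>j. 3 \<le> j \<Longrightarrow> Poly_Mapping.lookup m j = 0"
  shows "m = x_mon (Poly_Mapping.lookup m 0, Poly_Mapping.lookup m 1, Poly_Mapping.lookup m 2)"
proof (rule poly_mapping_eqI)
  fix j :: nat
  show "Poly_Mapping.lookup m j =
      Poly_Mapping.lookup (x_mon (Poly_Mapping.lookup m 0, Poly_Mapping.lookup m 1, Poly_Mapping.lookup m 2)) j"
    using assms[of j] less_3_cases[of j] unfolding lookup_x_mon by (cases "3 \<le> j") auto
qed

lemma x_mon_add: "x_mon (triple_add t u) = x_mon t + x_mon u"
  by (rule poly_mapping_eqI, cases t, cases u) (auto simp: lookup_add lookup_x_mon)

lemma x_mon_y_mon: "x_mon t + y_mon y = y_mon (fst y, triple_add t (snd y))"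
  by (simp add: y_mon_def x_mon_add add.assoc)

lemma mon_degree_x_mon [simp]: "mon_degree (x_mon t) = triple_degree t"
  by (cases t) (auto simp: x_mon.simps mon_degree_add)

lemma mon_degree_y_mon [simp]: "mon_degree (y_mon y) = Suc (triple_degree (snd y))"
  by (simp add: y_mon_def mon_degree_add)

lemma keys_x_mon: "Poly_Mapping.keys (x_mon t) \<subseteq> {..<3}"
  by (auto simp: in_keys_iff lookup_x_mon split: if_splits)

lemma keys_y_mon: "fst y < 2 \<Longrightarrow> Poly_Mapping.keys (y_mon y) \<subseteq> {..<5}"
  using keys_x_mon[of "snd y"] by (auto simp: y_mon_def keys_monomial_add)

lemma y_mon_neq_single: "5 \<le> k \<Longrightarrow> y_mon y \<noteq> Poly_Mapping.single k 30"
proof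
  assume k: "5 \<le> k" "y_mon y = Poly_Mapping.single k 30"
  then have "Poly_Mapping.lookup (y_mon y) k = 30" by simp
  then show False using k(1) by (auto simp: lookup_y_mon lookup_x_mon of_bool_def split: if_splits)
qed

lemma dual_form_y_mon: "dual_form r (y_mon y) = of_bool (snd y \<in> set (dual_supp (fst y)))"
  using y_mon_neq_single by (auto simp: dual_form_def y_mon_inj)

lemma dual_form_x_mon_y_mon: "dual_form r (x_mon t + y_mon y) = cat_entry t y"
  by (simp add: x_mon_y_mon dual_form_y_mon cat_entry_def)

lemma dual_form_degree: "dual_form r m \<noteq> 0 \<Longrightarrow> mon_degree m = 30"
  using dual_supp_degree by (fastforce simp: dual_form_def split: if_splits)

definition x_mons :: "nat \<Rightarrow> (nat \<Rightarrow>\<^sub>0 nat) set" where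
  "x_mons d = x_mon ` x_exp d"

text \<open>The variable y_i takes up one degree, hence \<open>d - 1\<close>; the set is only used
  for positive \<open>d\<close>.\<close>

definition y_mons :: "nat \<Rightarrow> (nat \<Rightarrow>\<^sub>0 nat) set" where
  "y_mons d = y_mon ` y_exp (d - 1)"

definition z_mons :: "nat \<Rightarrow> nat \<Rightarrow> (nat \<Rightarrow>\<^sub>0 nat) set" where
  "z_mons r d = (\<lambda>k. Poly_Mapping.single k d) ` {5..<r}"

text \<open>F is linear in the y_i, and the z_k occur only as pure powers. If m + n is an exponent
  of F, either exactly one factor carries a y_i, or both are powers of one z_k. The catalecticant
  matrix is therefore a sum of three blocks.\<close>

lemma dual_matrix_nonzero:
  assumes nz: "dual_form r (m + n) \<noteq> (0 :: 'k::field)" and deg: "1 \<le> mon_degree m" "1 \<le> mon_degree n"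
  shows "m \<in> x_mons (mon_degree m) \<and> n \<in> y_mons (mon_degree n) \<or>
    m \<in> y_mons (mon_degree m) \<and> n \<in> x_mons (mon_degree n) \<or>
    m \<in> z_mons r (mon_degree m) \<and> n \<in> z_mons r (mon_degree n)"
proof -
  have split_y: "a \<in> x_mons (mon_degree a) \<and> b \<in> y_mons (mon_degree b)"
    if ab: "a + b = y_mon y" "Poly_Mapping.lookup a (3 + fst y) = 0" and y: "fst y < 2" for a b y
  proof -
    have l: "Poly_Mapping.lookup a j + Poly_Mapping.lookup b j = Poly_Mapping.lookup (y_mon y) j" for j
      using ab(1) by (metis lookup_add)
    have z: "Poly_Mapping.lookup a j = 0" if "3 \<le> j" for j
      using l[of j] ab(2) that by (cases "j = 3 + fst y") (auto simp: lookup_y_mon lookup_x_mon)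
    define t where "t = (Poly_Mapping.lookup a 0, Poly_Mapping.lookup a 1, Poly_Mapping.lookup a 2)"
    define u where "u = (Poly_Mapping.lookup b 0, Poly_Mapping.lookup b 1, Poly_Mapping.lookup b 2)"
    have a: "a = x_mon t" unfolding t_def by (rule x_mon_lookup[OF z])
    have b: "b = y_mon (fst y, u)"
    proof (rule poly_mapping_eqI)
      fix j
      show "Poly_Mapping.lookup b j = Poly_Mapping.lookup (y_mon (fst y, u)) j"
        using l[of j] z[of j] less_3_cases[of j] by (cases "3 \<le> j") (auto simp: lookup_y_mon lookup_x_mon u_def)
    qed
    show ?thesis unfolding a b x_mons_def y_mons_def x_exp_def y_exp_def using y by auto
  qed
  from nz consider y where "m + n = y_mon y" "snd y \<in> set (dual_supp (fst y))"
    | k where "k \<in> {5..<r}" "m + n = Poly_Mapping.single k 30"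
    by (auto simp: dual_form_def split: if_splits)
  then show ?thesis
  proof cases
    case 1
    have y: "fst y < 2" by (rule dual_supp_index[OF 1(2)])
    have "Poly_Mapping.lookup m (3 + fst y) + Poly_Mapping.lookup n (3 + fst y) = 1"
      using arg_cong[OF 1(1), of "\<lambda>p. Poly_Mapping.lookup p (3 + fst y)"]
      by (simp add: lookup_add lookup_y_mon lookup_x_mon)
    then consider "Poly_Mapping.lookup m (3 + fst y) = 0" | "Poly_Mapping.lookup n (3 + fst y) = 0" by linarith
    then show ?thesis
      by cases (use split_y[of m n y] split_y[of n m y] 1(1) y in \<open>auto simp: add.commute\<close>)
  next
    case 2
    have "p = Poly_Mapping.single k (mon_degree p)" if pq: "p + q = Poly_Mapping.single k 30" for p q
    proof -
      have "Poly_Mapping.lookup p j = 0" if "j \<noteq> k" for j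
        using arg_cong[OF pq, of "\<lambda>p. Poly_Mapping.lookup p j"] that by (simp add: lookup_add lookup_single)
      then have "p = Poly_Mapping.single k (Poly_Mapping.lookup p k)"
        by (intro poly_mapping_eqI) (auto simp: lookup_single when_def)
      then show ?thesis by (metis mon_degree_single)
    qed
    from this[of m n] this[of n m] 2 have
      "m = Poly_Mapping.single k (mon_degree m)" "n = Poly_Mapping.single k (mon_degree n)"
      by (auto simp: add.commute)
    then show ?thesis unfolding z_mons_def using 2(1) by blast
  qed
qed

text \<open>Rows outside J are counted up to degree 17, columns from 18 on, where
  \<open>29 - j\<close> is at most 11.\<close>

definition a_rank :: "nat \<Rightarrow> nat" where
  "a_rank j = (if j \<le> 17 then length (x_part j) else length (y_part (29 - j)))"

text \<open>Both \<open>P\<close> and \<open>Q\<close> are needed: in a given degree the monomials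
  in the x_i and those with a factor y_i both occur as rows, and the second block is a transpose of
  the first in the complementary degree.\<close>

lemma rank_x_y:
  assumes "j \<le> 29"
  shows "\<exists>P Q. row_basis (dual_matrix r :: _ \<Rightarrow> _ \<Rightarrow> 'k::field) (x_mons j) (y_mons (30 - j)) P \<and>
    row_basis (dual_matrix r :: _ \<Rightarrow> _ \<Rightarrow> 'k) (y_mons (30 - j)) (x_mons j) Q \<and>
    card P = a_rank j \<and> card Q = a_rank j"
proof (cases "j \<le> 17")
  case True
  obtain ps where ps: "triangular (cat_entry :: _ \<Rightarrow> _ \<Rightarrow> 'k) ps" "fst ` set ps = set (x_part j)"
    using triangular_x[OF True] by blast
  let ?qs = "map (map_prod x_mon y_mon) ps"
  have tri: "triangular (dual_matrix r :: _ \<Rightarrow> _ \<Rightarrow> 'k) ?qs"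
    by (rule triangular_map[OF ps(1)]) (simp add: dual_form_x_mon_y_mon)
  have fst_qs: "fst ` set ?qs = x_mon ` set (x_part j)" unfolding ps(2)[symmetric] by (auto simp: image_image)
  have "snd p \<in> y_exp (29 - j)" if "p \<in> set ps" for p
  proof -
    have "triple_degree (fst p) = j" using that ps(2) by (auto simp: set_x_part x_exp_def)
    then show ?thesis using cat_entry_degree[OF triangular_nonzero[OF ps(1) that]] by (auto simp: y_exp_def)
  qed
  then have sub: "fst ` set ?qs \<subseteq> x_mons j" "snd ` set ?qs \<subseteq> y_mons (30 - j)"
    unfolding fst_qs by (auto simp: set_x_part x_mons_def y_mons_def)
  \<comment> \<open>The rows without a pivot are the monomials of J.\<close>
  have zero: "dual_matrix r m n = (0 :: 'k)"
    if m: "m \<in> x_mons j" "m \<notin> fst ` set ?qs" and n: "n \<in> y_mons (30 - j)" for m n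
  proof -
    obtain t y where ty: "m = x_mon t" "triple_degree t = j" "n = y_mon y"
      using m(1) n unfolding x_mons_def y_mons_def x_exp_def by blast
    then have "t \<notin> set (x_part j)" using m(2) unfolding fst_qs by blast
    then show ?thesis using ty cat_entry_x_part[of t j] assms by (simp add: dual_form_x_mon_y_mon)
  qed
  have "length ps = a_rank j"
    using row_basis_triangular(3)[OF tri sub zero] ps(2) True distinct_card[OF distinct_x_part]
      card_image[of x_mon "set (x_part j)"] unfolding fst_qs a_rank_def
    by (simp add: inj_on_def x_mon_inj)
  then show ?thesis
    using row_basis_triangular[OF tri sub zero] by (auto simp: add.commute)
next
  case False
  then have j: "29 - j \<le> 11" by simp
  obtain ps where ps: "triangular (\<lambda>y t. cat_entry t y :: 'k) ps" "fst ` set ps = set (y_part (29 - j))"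
    using triangular_y[OF j] by blast
  let ?qs = "map (map_prod y_mon x_mon) ps"
  have tri: "triangular (dual_matrix r :: _ \<Rightarrow> _ \<Rightarrow> 'k) ?qs"
    by (rule triangular_map[OF ps(1)]) (simp add: dual_form_x_mon_y_mon add.commute[of "y_mon _"])
  have fst_qs: "fst ` set ?qs = y_mons (30 - j)"
    unfolding y_mons_def set_y_part[symmetric]
    using ps(2) assms by (simp add: image_image) (metis image_image)
  have "snd p \<in> x_exp j" if "p \<in> set ps" for p
  proof -
    have "triple_degree (snd (fst p)) = 29 - j" using that ps(2) by (auto simp: set_y_part y_exp_def)
    then show ?thesis using cat_entry_degree[OF triangular_nonzero[OF ps(1) that]] assms by (auto simp: x_exp_def)
  qed
  then have sub: "fst ` set ?qs \<subseteq> y_mons (30 - j)" "snd ` set ?qs \<subseteq> x_mons j"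
    unfolding fst_qs by (auto simp: x_mons_def)
  \<comment> \<open>Here every row carries a pivot, so the condition is vacuous.\<close>
  have zero: "dual_matrix r m n = (0 :: 'k)"
    if "m \<in> y_mons (30 - j)" "m \<notin> fst ` set ?qs" for m n
    using that fst_qs by blast
  have "length ps = a_rank j"
    using row_basis_triangular(3)[OF tri sub zero] ps(2) False distinct_card[OF distinct_y_part]
      card_image[of y_mon "set (y_part (29 - j))"] assms unfolding fst_qs a_rank_def
    by (simp add: inj_on_def y_mon_inj y_mons_def set_y_part)
  then show ?thesis
    using row_basis_triangular[OF tri sub zero] by (auto simp: add.commute)
qed

text \<open>The block is an identity matrix: for \<open>k\<close> different from \<open>l\<close>
  the product involves two distinct variables z and does not occur in F.\<close>

lemma rank_z:
  assumes "1 \<le> d" "d \<le> 29"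
  shows "row_basis (dual_matrix r :: _ \<Rightarrow> _ \<Rightarrow> 'k::field) (z_mons r d) (z_mons r (30 - d)) (z_mons r d)"
    and "card (z_mons r d) = r - 5"
proof -
  have entry: "dual_matrix r (Poly_Mapping.single k d) (Poly_Mapping.single l (30 - d)) = (of_bool (k = l) :: 'k)"
    if "5 \<le> k" "5 \<le> l" "k < r" for k l
  proof (cases "k = l")
    case True
    then show ?thesis using that assms by (auto simp: dual_form_def single_add[symmetric])
  next
    case False
    let ?m = "Poly_Mapping.single k d + Poly_Mapping.single l (30 - d)"
    have lk: "Poly_Mapping.lookup ?m k = d" "Poly_Mapping.lookup ?m l = 30 - d"
      using False by (auto simp: lookup_add lookup_single when_def)
    have "?m \<noteq> Poly_Mapping.single i 30" for i
      using lk assms by (auto simp: lookup_single when_def split: if_splits)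
    moreover have "?m \<noteq> y_mon y" if "snd y \<in> set (dual_supp (fst y))" for y
      using lk(1) assms dual_supp_index[OF that] \<open>5 \<le> k\<close> by (auto simp: lookup_y_mon lookup_x_mon)
    ultimately have "\<not> ((\<exists>y. ?m = y_mon y \<and> snd y \<in> set (dual_supp (fst y))) \<or>
        (\<exists>i\<in>{5..<r}. ?m = Poly_Mapping.single i 30))"
      by blast
    then show ?thesis using False unfolding dual_form_def by simp
  qed
  let ?ps = "\<lambda>ks. map (\<lambda>k. (Poly_Mapping.single k d, Poly_Mapping.single k (30 - d))) ks"
  have tri: "triangular (dual_matrix r :: _ \<Rightarrow> _ \<Rightarrow> 'k) (?ps ks)" if "distinct ks" "set ks \<subseteq> {5..<r}" for ks
    using that
  proof (induction ks)
    case (Cons k ks)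
    have "k' \<noteq> k" "5 \<le> k'" "k' < r" if "k' \<in> set ks" for k' using Cons.prems that by auto
    then show ?case using Cons by (auto intro!: triangular.Cons simp: entry)
  qed (simp add: triangular.Nil)
  have "fst ` set (?ps [5..<r]) = z_mons r d" "snd ` set (?ps [5..<r]) = z_mons r (30 - d)"
    by (simp_all add: z_mons_def image_image)
  then show "row_basis (dual_matrix r :: _ \<Rightarrow> _ \<Rightarrow> 'k) (z_mons r d) (z_mons r (30 - d)) (z_mons r d)"
    "card (z_mons r d) = r - 5"
    using row_basis_triangular[OF tri[of "[5..<r]"], of "z_mons r d" "z_mons r (30 - d)"] by auto
qed

lemma x_y_z_mons_subset:
  assumes "5 \<le> r" "1 \<le> d" "d \<le> 29"
  shows "x_mons d \<union> y_mons d \<union> z_mons r d \<subseteq> monomials r d"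
proof -
  have "{..<3} \<subseteq> {..<r}" "{..<5} \<subseteq> {..<r}" using assms(1) by auto
  then show ?thesis
    using keys_x_mon keys_y_mon assms
    by (fastforce simp: monomials_def x_mons_def y_mons_def z_mons_def x_exp_def y_exp_def)
qed

lemma x_y_z_disjoint:
  assumes "1 \<le> d"
  shows "x_mons d \<inter> y_mons d = {}" "x_mons d \<inter> z_mons r d = {}" "y_mons d \<inter> z_mons r d = {}"
proof -
  have "x_mon t \<noteq> y_mon y" for t y
  proof
    assume "x_mon t = y_mon y"
    then have "Poly_Mapping.lookup (x_mon t) (3 + fst y) = Poly_Mapping.lookup (y_mon y) (3 + fst y)" by simp
    then show False by (simp add: lookup_x_mon lookup_y_mon)
  qed
  then show "x_mons d \<inter> y_mons d = {}" by (auto simp: x_mons_def y_mons_def)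
  have "x_mon t \<noteq> Poly_Mapping.single k d" if "5 \<le> k" for t k
  proof
    assume "x_mon t = Poly_Mapping.single k d"
    then have "Poly_Mapping.lookup (x_mon t) k = d" by simp
    then show False using that assms by (simp add: lookup_x_mon)
  qed
  then show "x_mons d \<inter> z_mons r d = {}" by (auto simp: x_mons_def z_mons_def)
  have "y_mon y \<noteq> Poly_Mapping.single k d" if "5 \<le> k" "fst y < 2" for y k
  proof
    assume "y_mon y = Poly_Mapping.single k d"
    then have "Poly_Mapping.lookup (y_mon y) k = d" by simp
    then show False using that assms by (auto simp: lookup_x_mon lookup_y_mon)
  qed
  then show "y_mons d \<inter> z_mons r d = {}" by (auto simp: y_mons_def z_mons_def y_exp_def)
qed

text \<open>Three diagonal blocks, completed by a zero block for all monomials that divide no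
  monomial of F in a way seen by \<open>dual_matrix_nonzero\<close>.\<close>

lemma rank_middle:
  assumes r: "5 \<le> r" and d: "1 \<le> d" "d \<le> 29"
  shows "\<exists>B. row_basis (dual_matrix r :: _ \<Rightarrow> _ \<Rightarrow> 'k::field) (monomials r d) (monomials r (30 - d)) B \<and>
    card B = a_rank d + a_rank (30 - d) + (r - 5)"
proof -
  let ?A = "dual_matrix r :: _ \<Rightarrow> _ \<Rightarrow> 'k" and ?e = "30 - d"
  have e: "1 \<le> ?e" "?e \<le> 29" "30 - ?e = d" using d by auto
  obtain P where P: "row_basis ?A (x_mons d) (y_mons ?e) P" "card P = a_rank d"
    using rank_x_y[OF d(2)] by blast
  obtain Q where Q: "row_basis ?A (y_mons d) (x_mons ?e) Q" "card Q = a_rank ?e"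
    using rank_x_y[OF e(2)] e(3) by metis
  have R: "row_basis ?A (z_mons r d) (z_mons r ?e) (z_mons r d)" "card (z_mons r d) = r - 5"
    using rank_z[OF d] by blast+
  let ?M = "monomials r d" and ?N = "monomials r ?e"
  let ?Mr = "?M - (x_mons d \<union> y_mons d \<union> z_mons r d)" and ?Nr = "?N - (x_mons ?e \<union> y_mons ?e \<union> z_mons r ?e)"
  have MN: "x_mons d \<union> y_mons d \<union> z_mons r d \<subseteq> ?M" "x_mons ?e \<union> y_mons ?e \<union> z_mons r ?e \<subseteq> ?N"
    by (rule x_y_z_mons_subset[OF r d] x_y_z_mons_subset[OF r e(1,2)])+
  have nz: "m \<in> x_mons d \<and> n \<in> y_mons ?e \<or> m \<in> y_mons d \<and> n \<in> x_mons ?e \<or> m \<in> z_mons r d \<and> n \<in> z_mons r ?e"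
    if "m \<in> ?M" "n \<in> ?N" "?A m n \<noteq> 0" for m n
    using dual_matrix_nonzero[OF that(3)] that(1,2) d e(1) by (simp add: monomials_def)
  note disj = x_y_z_disjoint[OF d(1)] x_y_z_disjoint[OF e(1)]
  have "row_basis ?A (x_mons d \<union> y_mons d) (y_mons ?e \<union> x_mons ?e) (P \<union> Q)"
    by (rule row_basis_Un[OF P(1) Q(1)]) (use nz MN disj in blast)+
  then have "row_basis ?A (x_mons d \<union> y_mons d \<union> z_mons r d) (y_mons ?e \<union> x_mons ?e \<union> z_mons r ?e) (P \<union> Q \<union> z_mons r d)"
    by (rule row_basis_Un[OF _ R(1)]) (use nz MN disj in blast)+
  moreover have "row_basis ?A ?Mr ?Nr {}" by (rule row_basis_zero) (use nz in blast)
  ultimately have "row_basis ?A (x_mons d \<union> y_mons d \<union> z_mons r d \<union> ?Mr)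
      (y_mons ?e \<union> x_mons ?e \<union> z_mons r ?e \<union> ?Nr) (P \<union> Q \<union> z_mons r d \<union> {})"
    by (rule row_basis_Un) (use nz MN in blast)+
  moreover have "x_mons d \<union> y_mons d \<union> z_mons r d \<union> ?Mr = ?M" "y_mons ?e \<union> x_mons ?e \<union> z_mons r ?e \<union> ?Nr = ?N"
    using MN by blast+
  moreover have "card (P \<union> Q \<union> z_mons r d) = a_rank d + a_rank ?e + (r - 5)"
  proof -
    have fin: "finite P" "finite Q" "finite (z_mons r d)" and sub: "P \<subseteq> x_mons d" "Q \<subseteq> y_mons d"
      using P(1) Q(1) by (auto simp: row_basis_def z_mons_def)
    have "P \<inter> Q = {}" "(P \<union> Q) \<inter> z_mons r d = {}" using sub disj by blast+
    then show ?thesis using fin P(2) Q(2) R(2) by (simp add: card_Un_disjoint)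
  qed
  ultimately show ?thesis by (intro exI[of _ "P \<union> Q \<union> z_mons r d"]) simp
qed

text \<open>The end degrees are separate, because there the z_k^d no longer form an independent
  block: z_k^0 is 1 for every k.\<close>

definition h_value :: "nat \<Rightarrow> nat \<Rightarrow> nat" where
  "h_value r d = (if d = 0 \<or> d = 30 then 1 else a_rank d + a_rank (30 - d) + (r - 5))"

lemma rank_dual_form:
  assumes r: "5 \<le> r" and d: "d \<le> 30"
  shows "\<exists>B. row_basis (dual_matrix r :: _ \<Rightarrow> _ \<Rightarrow> 'k::field) (monomials r d) (monomials r (30 - d)) B \<and>
    card B = h_value r d"
proof -
  \<comment> \<open>Any monomial of F would do: it shows that the pairing between degrees 0 and 30
    is nonzero.\<close>
  let ?b = "y_mon (0, (5, 19, 5))"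
  have b: "?b \<in> monomials r 30" "dual_form r ?b = (1 :: 'k)"
    using keys_y_mon[of "(0, (5, 19, 5))"] r
    by (auto simp: monomials_def dual_form_y_mon dual_supp_def)
  have M0: "monomials r 0 = {0}" by (auto simp: monomials_def)
  consider "d = 0" | "d = 30" | "1 \<le> d" "d \<le> 29" using d by linarith
  then show ?thesis
  proof cases
    case 1
    have "row_basis (dual_matrix r :: _ \<Rightarrow> _ \<Rightarrow> 'k) {0} (monomials r 30) {0}"
      unfolding row_basis_def using b by (auto intro!: exI[of _ "\<lambda>_. 1"] bexI[of _ ?b])
    then show ?thesis using 1 M0 by (intro exI[of _ "{0}"]) (simp add: h_value_def)
  next
    case 2
    have "row_basis (dual_matrix r :: _ \<Rightarrow> _ \<Rightarrow> 'k) (monomials r 30) {0} {?b}"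
      unfolding row_basis_def using b by (auto intro!: exI[of _ "\<lambda>_. dual_form r _"])
    then show ?thesis using 2 M0 by (intro exI[of _ "{?b}"]) (simp add: h_value_def)
  next
    case 3
    then show ?thesis using rank_middle[OF r 3] by (simp add: h_value_def)
  qed
qed

lemma card_monomials_1: "finite (monomials r 1)" "card (monomials r 1) = r"
proof -
  let ?e = "\<lambda>i. Poly_Mapping.single i (1::nat) :: nat \<Rightarrow>\<^sub>0 nat"
  have "monomials r 1 = ?e ` {..<r}"
  proof (intro equalityI subsetI)
    fix m assume m: "m \<in> monomials r 1"
    then have "m \<noteq> 0" by (auto simp: monomials_def)
    then obtain i where i: "i \<in> Poly_Mapping.keys m" by (metis all_not_in_conv keys_eq_empty)
    have mi: "m = ?e i + (m - ?e i)"
      by (rule poly_mapping_eqI)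
        (use i in \<open>auto simp: lookup_add lookup_minus lookup_single when_def in_keys_iff\<close>)
    have "mon_degree m = mon_degree (?e i) + mon_degree (m - ?e i)" by (subst mi) (rule mon_degree_add)
    then have "m - ?e i = 0" using m by (simp add: monomials_def)
    then show "m \<in> ?e ` {..<r}" using mi i m by (auto simp: monomials_def)
  qed (auto simp: monomials_def)
  moreover have "inj ?e" by (rule injI) (metis keys_single singleton_inject zero_neq_one)
  ultimately show "finite (monomials r 1)" "card (monomials r 1) = r"
    by (auto simp: card_image inj_on_subset)
qed

text \<open>Binomials C(j+2, 2) up to 136, then 153 - 2 and 171 - 5 in degrees 16 and 17, and 2
  C(31-j, 2) from degree 18 on.\<close>

lemma a_rank_values:
  "map a_rank [0..<30] = [1, 3, 6, 10, 15, 21, 28, 36, 45, 55, 66, 78, 91, 105, 120, 136, 151, 166,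
    156, 132, 110, 90, 72, 56, 42, 30, 20, 12, 6, 2]"
  by code_simp

lemma h_value_list:
  "map (h_value r) [0..<31] = 1 # map (\<lambda>a. a + (r - 5)) [5, 12, 22, 35, 51, 70, 92, 117, 145, 176, 210, 247,
     271, 271, 272, 271, 271, 247, 210, 176, 145, 117, 92, 70, 51, 35, 22, 12, 5] @ [1]"
proof -
  \<comment> \<open>As \<open>r\<close> is symbolic, the sequence is not evaluated directly; each
    rank is read off the list computed before.\<close>
  have "a_rank d = map a_rank [0..<30] ! d" if "d < 30" for d using that by simp
  note a = this[unfolded a_rank_values]
  show ?thesis by (simp add: upt_rec h_value_def a)
qed

theorem theorem3p4:
  fixes r :: nat
  assumes "infinite (UNIV :: 'k::field set)" and "r \<ge> 5"
  shows "\<exists>(h :: nat list) e. length h = e + 1 \<and> 1 \<le> e \<and>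
           h ! 0 = 1 \<and> h ! 1 = r \<and> h ! e = 1 \<and>
           gorenstein_h_vector TYPE('k) h \<and> unimodal h \<and> \<not> SI_sequence TYPE('k) h"
proof -
  obtain B where B: "\<And>d. d \<le> 30 \<Longrightarrow>
      row_basis (dual_matrix r :: _ \<Rightarrow> _ \<Rightarrow> 'k) (monomials r d) (monomials r (30 - d)) (B d)"
      "\<And>d. d \<le> 30 \<Longrightarrow> card (B d) = h_value r d"
    using rank_dual_form[OF assms(2), where 'k = 'k] by metis
  define h where "h = map (h_value r) [0..<31]"
  have nth: "h ! d = h_value r d" if "d \<le> 30" for d using that by (simp add: h_def del: upt_Suc)
  note h = h_def[unfolded h_value_list]
  have h1: "h ! 1 = r" using assms(2) by (simp add: h)
  \<comment> \<open>A subset with \<open>r\<close> elements of the \<open>r\<close> monomials of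
    degree 1.\<close>
  have "B 1 = monomials r 1"
    using B(1)[of 1] B(2)[of 1] h1 nth[of 1] card_monomials_1[of r]
    by (intro card_subset_eq) (auto simp: row_basis_def)
  then interpret apolar_form r 30 "dual_form r :: _ \<Rightarrow> 'k" B
    using dual_form_degree B by unfold_locales (auto simp: h_value_def)
  have "h = h_vector r (apolar_ideal r (dual_form r :: _ \<Rightarrow> 'k))"
    unfolding h_vector_eq h_def by (rule map_cong) (auto simp: B(2))
  then have "gorenstein_h_vector TYPE('k) h" unfolding gorenstein_h_vector_def using gorenstein by blast
  moreover have "unimodal h"
  proof -
    \<comment> \<open>The peak is h_15, the middle entry.\<close>
    have up: "h ! i \<le> h ! Suc i" if "i < 15" for i
      using that assms(2) by (auto simp: h less_Suc_eq numeral_eq_Suc)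
    have down: "h ! Suc i \<le> h ! i" if "15 \<le> i" "i < 30" for i
      using that assms(2) by (auto simp: h less_Suc_eq numeral_eq_Suc)
    have "length h = 31" by (simp add: h_def)
    show ?thesis unfolding unimodal_def
    proof clarify
      fix i j assume ij: "i < j" "Suc j < length h" "h ! Suc i < h ! i" "h ! j < h ! Suc j"
      then have "15 \<le> i" using up[of i] by linarith
      then show False using down[of j] ij \<open>length h = 31\<close> by linarith
    qed
  qed
  moreover have "\<not> SI_sequence TYPE('k) h"
    \<comment> \<open>The entries 13, 14, 15 are 271, 271, 272, each shifted by r - 5, and 15 is the
      end of the first half.\<close>
    by (rule not_SI_sequence[of 14]) (simp_all add: h)
  moreover have "length h = 30 + 1" "h ! 0 = 1" "h ! 30 = 1" by (simp_all add: h)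
  ultimately show ?thesis using h1 by (intro exI[of _ h] exI[of _ 30]) simp
qed

end
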